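(* A graph $G$, distinct from $C_4$, is a $2$-edge extremal minimal bipartite matching covered graph if and only if its partial retract $\widehat{G}$ is a $2$-vertex extremal minimal bipartite matching covered graph.
   Context: All graphs are finite and loopless; parallel edges are allowed. For a graph with vertex set $V$ and edge set $E$ write $n=|V|$ and $m=|E|$. A connected graph on four or more vertices is matching covered if every edge lies in some perfect matching. A matching covered graph is minimal if deleting any single edge yields a graph that is not matching covered. $V_2$ denotes the set of vertices of degree two, and $E_2$ the set of $2$-edges, i.e. edges both of whose ends have degree two. A minimal bipartite matching covered graph is $2$-edge extremal if $|E_2|=m-n+2$, and $2$-vertex extremal if $|V_2|=2(m-n+2)$. Let $v$ be a vertex of degree two of a graph $G$ with two distinct neighbours $v_1,v_2$. The bicontraction $G/v$ is obtained from $G$ by contracting the two edges $vv_1$ and $vv_2$ (all other edges are kept, so parallel edges may arise; an edge $v_1v_2$, which cannot exist in a bipartite graph, would become a loop). It is a restricted bicontraction if both $v_1$ and $v_2$ have degree at least three in $G$. The partial retract $\widehat{G}$ of $G$ is the graph obtained by repeatedly applying restricted bicontraction until it can no longer be applied (i.e. until the subgraph induced by the degree-two vertices has no isolated vertex); it is unique up to isomorphism. *)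

theory Defs
  imports Main
begin

text \<open>Undirected multigraphs. Each edge is mapped to the set of its ends; a singleton
  set of ends encodes a loop, and distinct edges with the same ends are parallel.\<close>

record ('v, 'e) mgraph =
  verts :: "'v set"
  edges :: "'e set"
  ends :: "'e \<Rightarrow> 'v set"

text \<open>The standing convention is that graphs are finite and loopless. Loops are
  nevertheless representable, because a bicontraction may create one.\<close>

definition graph :: "('v, 'e) mgraph \<Rightarrow> bool" where
  "graph G \<longleftrightarrow> finite (verts G) \<and> finite (edges G) \<and>
     (\<forall>e\<in>edges G. ends G e \<subseteq> verts G \<and> card (ends G e) = 2)"

definition isomorphic :: "('v, 'e) mgraph \<Rightarrow> ('w, 'f) mgraph \<Rightarrow> bool" where
  "isomorphic G H \<longleftrightarrow>
     (\<exists>f g. bij_betw f (verts G) (verts H) \<and> bij_betw g (edges G) (edges H) \<and>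
            (\<forall>e\<in>edges G. ends H (g e) = f ` ends G e))"

definition C4 :: "(nat, nat) mgraph" where
  "C4 = \<lparr>verts = {..<4}, edges = {..<4}, ends = (\<lambda>i. {i, (i + 1) mod 4})\<rparr>"

text \<open>A loop contributes two to the degree of its end.\<close>

definition degree :: "('v, 'e) mgraph \<Rightarrow> 'v \<Rightarrow> nat" where
  "degree G v = card {e \<in> edges G. v \<in> ends G e} + card {e \<in> edges G. ends G e = {v}}"

definition neighbours :: "('v, 'e) mgraph \<Rightarrow> 'v \<Rightarrow> 'v set" where
  "neighbours G v = {w. \<exists>e\<in>edges G. ends G e = {v, w}}"

definition connected_graph :: "('v, 'e) mgraph \<Rightarrow> bool" where
  "connected_graph G \<longleftrightarrow> verts G \<noteq> {} \<and>
     (\<forall>u\<in>verts G. \<forall>w\<in>verts G. (\<lambda>x y. y \<in> neighbours G x)\<^sup>*\<^sup>* u w)"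

text \<open>For edges with at most two ends, meeting both of the disjoint sets \<open>A\<close> and \<open>B\<close>
  means having exactly one end in each; in particular there are no loops.\<close>

definition bipartite :: "('v, 'e) mgraph \<Rightarrow> bool" where
  "bipartite G \<longleftrightarrow>
     (\<exists>A B. A \<union> B = verts G \<and> A \<inter> B = {} \<and>
            (\<forall>e\<in>edges G. ends G e \<inter> A \<noteq> {} \<and> ends G e \<inter> B \<noteq> {}))"

definition perfect_matching :: "('v, 'e) mgraph \<Rightarrow> 'e set \<Rightarrow> bool" where
  "perfect_matching G M \<longleftrightarrow> M \<subseteq> edges G \<and> (\<forall>v\<in>verts G. \<exists>!e. e \<in> M \<and> v \<in> ends G e)"

definition matching_covered :: "('v, 'e) mgraph \<Rightarrow> bool" where
  "matching_covered G \<longleftrightarrow> graph G \<and> connected_graph G \<and> card (verts G) \<ge> 4 \<and>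
     (\<forall>e\<in>edges G. \<exists>M. perfect_matching G M \<and> e \<in> M)"

definition delete_edge :: "('v, 'e) mgraph \<Rightarrow> 'e \<Rightarrow> ('v, 'e) mgraph" where
  "delete_edge G e = G\<lparr>edges := edges G - {e}\<rparr>"

definition minimal_matching_covered :: "('v, 'e) mgraph \<Rightarrow> bool" where
  "minimal_matching_covered G \<longleftrightarrow> matching_covered G \<and>
     (\<forall>e\<in>edges G. \<not> matching_covered (delete_edge G e))"

definition V2 :: "('v, 'e) mgraph \<Rightarrow> 'v set" where
  "V2 G = {v \<in> verts G. degree G v = 2}"

definition E2 :: "('v, 'e) mgraph \<Rightarrow> 'e set" where
  "E2 G = {e \<in> edges G. ends G e \<subseteq> V2 G}"

definition two_edge_extremal_mbmc :: "('v, 'e) mgraph \<Rightarrow> bool" where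
  "two_edge_extremal_mbmc G \<longleftrightarrow> bipartite G \<and> minimal_matching_covered G \<and>
     int (card (E2 G)) = int (card (edges G)) - int (card (verts G)) + 2"

definition two_vertex_extremal_mbmc :: "('v, 'e) mgraph \<Rightarrow> bool" where
  "two_vertex_extremal_mbmc G \<longleftrightarrow> bipartite G \<and> minimal_matching_covered G \<and>
     int (card (V2 G)) = 2 * (int (card (edges G)) - int (card (verts G)) + 2)"

text \<open>The bicontraction \<open>G/v\<close>, meaningful when \<open>v\<close> has degree two and two distinct
  neighbours. The edges at \<open>v\<close> disappear, \<open>v\<close> itself serves as the contraction vertex,
  and the ends of the remaining edges are relabelled accordingly. An edge joining the
  two neighbours thus becomes a loop at \<open>v\<close>.\<close>

definition bicontraction :: "('v, 'e) mgraph \<Rightarrow> 'v \<Rightarrow> ('v, 'e) mgraph" where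
  "bicontraction G v =
     \<lparr>verts = verts G - neighbours G v,
      edges = {e \<in> edges G. v \<notin> ends G e},
      ends = (\<lambda>e. (\<lambda>u. if u \<in> neighbours G v then v else u) ` ends G e)\<rparr>"

definition restricted_bicontraction :: "('v, 'e) mgraph \<Rightarrow> ('v, 'e) mgraph \<Rightarrow> bool" where
  "restricted_bicontraction G H \<longleftrightarrow>
     (\<exists>v v1 v2. v \<in> verts G \<and> degree G v = 2 \<and> v1 \<noteq> v2 \<and> neighbours G v = {v1, v2} \<and>
        degree G v1 \<ge> 3 \<and> degree G v2 \<ge> 3 \<and> H = bicontraction G v)"

text \<open>The partial retract is unique only up to isomorphism, so it is a relation:
  \<open>H\<close> is the outcome of some maximal sequence of restricted bicontractions.\<close>

definition partial_retract :: "('v, 'e) mgraph \<Rightarrow> ('v, 'e) mgraph \<Rightarrow> bool" where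
  "partial_retract G H \<longleftrightarrow> restricted_bicontraction\<^sup>*\<^sup>* G H \<and> (\<nexists>K. restricted_bicontraction H K)"

lemma restricted_bicontraction_decreases:
  assumes "restricted_bicontraction G H" and "finite (edges G)"
  shows "finite (edges H)" and "card (edges H) < card (edges G)"
proof -
  obtain v v1 v2 where n: "neighbours G v = {v1, v2}" and H: "H = bicontraction G v"
    using assms(1) unfolding restricted_bicontraction_def by blast
  from n obtain e where e: "e \<in> edges G" "ends G e = {v, v1}"
    unfolding neighbours_def by blast
  have "edges H \<subset> edges G"
    using e by (auto simp: H bicontraction_def)
  then show "finite (edges H)" "card (edges H) < card (edges G)"
    using assms(2) by (auto intro: finite_subset psubset_card_mono)
qed

lemma partial_retract_exists:
  assumes "finite (edges G)"
  shows "\<exists>H. partial_retract G H"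
  using assms
proof (induction "card (edges G)" arbitrary: G rule: less_induct)
  case less
  show ?case
  proof (cases "\<exists>K. restricted_bicontraction G K")
    case True
    then obtain K where K: "restricted_bicontraction G K" by blast
    obtain H where "partial_retract K H"
      using less restricted_bicontraction_decreases[OF K] by blast
    then show ?thesis
      using K unfolding partial_retract_def by (meson converse_rtranclp_into_rtranclp)
  next
    case False
    then show ?thesis unfolding partial_retract_def by blast
  qed
qed

end

theory Submission
  imports Defs
begin

text \<open>A bipartite graph with colour classes \<open>A\<close> and \<open>B\<close> is matching covered iff
  \<open>|A| = |B| \<ge> 2\<close> and every nonempty proper subset \<open>X\<close> of \<open>A\<close> has more than \<open>|X|\<close>
  neighbours. In this form it is easy to see that restricted bicontraction, in both
  directions, preserves being a minimal bipartite matching covered graph; it also preserves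
  \<open>m - n\<close> and \<open>E\<^sub>2\<close>. So the question is about the partial retract \<open>H\<close> alone, in which every
  vertex of degree two has a neighbour of degree two; hence \<open>|V\<^sub>2| \<le> 2|E\<^sub>2|\<close>.

  The heart of the matter is the bound \<open>|V\<^sub>2| \<ge> 2(m - n + 2)\<close>, which holds in each colour class
  separately: in \<open>H\<close>, deleting from \<open>A\<close> all but one of the vertices of degree two leaves a
  forest, and counting its edges gives the bound. With it, \<open>|E\<^sub>2| = m - n + 2\<close> forces
  \<open>|V\<^sub>2| = 2(m - n + 2)\<close>. Conversely, if \<open>|V\<^sub>2| = 2(m - n + 2)\<close>, then no three vertices of degree
  two form a path, since bicontracting the middle one would violate the bound; so \<open>E\<^sub>2\<close> is a
  perfect matching of \<open>V\<^sub>2\<close>. The exception is \<open>C\<^sub>4\<close>, which is no proper partial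
  retract, as a restricted bicontraction creates a vertex of degree at least four.\<close>

subsection \<open>Hall's theorem and forests\<close>

text \<open>Induction on \<open>card A\<close>. If every nonempty proper subset has a spare
  neighbour, any \<open>a\<close> may be matched to any neighbour \<open>b\<close>, since removing
  \<open>b\<close> costs each neighbourhood at most one. Otherwise a set \<open>X\<close> with
  exactly \<open>card X\<close> neighbours splits the problem: \<open>X\<close> is matched into its
  neighbourhood N(X), the rest outside it.\<close>

lemma hall_marriage:
  assumes "finite A" "finite E" and "\<And>X. X \<subseteq> A \<Longrightarrow> card X \<le> card (E `` X)"
  shows "\<exists>f. inj_on f A \<and> (\<forall>a\<in>A. (a, f a) \<in> E)"
  using assms
proof (induction "card A" arbitrary: A E rule: less_induct)
  case less
  have fin: "finite (E `` X)" for X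
    using less.prems(2) by (rule finite_Image)
  consider "A = {}"
    | (loose) "A \<noteq> {}" "\<And>X. X \<subseteq> A \<Longrightarrow> X \<noteq> {} \<Longrightarrow> X \<noteq> A \<Longrightarrow> card X < card (E `` X)"
    | (tight) X where "X \<subseteq> A" "X \<noteq> {}" "X \<noteq> A" "card (E `` X) = card X"
    using less.prems(3) by (metis le_neq_implies_less)
  then show ?case
  proof cases
    case loose
    then obtain a where a: "a \<in> A" by blast
    have "card (E `` {a}) \<ge> 1" using less.prems(3)[of "{a}"] a by simp
    then obtain b where b: "(a, b) \<in> E"
      by (metis Image_singleton_iff card.empty ex_in_conv not_one_le_zero)
    define E' where "E' = E - UNIV \<times> {b}"
    have "\<exists>f. inj_on f (A - {a}) \<and> (\<forall>x\<in>A - {a}. (x, f x) \<in> E')"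
    proof (rule less.hyps)
      show "card (A - {a}) < card A" using less.prems(1) a by (rule card_Diff1_less)
      show "finite (A - {a})" "finite E'" using less.prems by (auto simp: E'_def)
      fix X assume X: "X \<subseteq> A - {a}"
      show "card X \<le> card (E' `` X)"
      proof (cases "X = {}")
        case False
        then have "card X < card (E `` X)" using loose(2)[of X] X a by blast
        moreover have "card (E `` X) \<le> Suc (card (E `` X - {b}))"
          by (simp add: card_Diff_singleton_if) linarith
        moreover have "E' `` X = E `` X - {b}" by (auto simp: E'_def)
        ultimately show ?thesis by simp
      qed simp
    qed
    then obtain f where f: "inj_on f (A - {a})" "\<forall>x\<in>A - {a}. (x, f x) \<in> E'" by blast
    have "inj_on (f(a := b)) A"
      using f unfolding inj_on_def E'_def by (auto simp: fun_upd_def)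
    moreover have "\<forall>x\<in>A. (x, (f(a := b)) x) \<in> E"
      using f(2) b by (auto simp: E'_def)
    ultimately show ?thesis by blast
  next
    case (tight X)
    have fX: "finite X" using tight(1) less.prems(1) finite_subset by blast
    have "\<exists>f. inj_on f X \<and> (\<forall>x\<in>X. (x, f x) \<in> E)"
      using less.hyps[OF _ fX less.prems(2)] tight less.prems
      by (meson psubsetI psubset_card_mono subset_trans)
    then obtain f where f: "inj_on f X" "\<forall>x\<in>X. (x, f x) \<in> E" by blast
    \<comment> \<open>The Hall condition survives outside N(X): a set \<open>Y\<close> disjoint from
      \<open>X\<close> has few neighbours there only if the union of \<open>X\<close> and
      \<open>Y\<close> has few neighbours altogether.\<close>
    define E' where "E' = E - UNIV \<times> (E `` X)"
    have "\<exists>g. inj_on g (A - X) \<and> (\<forall>x\<in>A - X. (x, g x) \<in> E')"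
    proof (rule less.hyps)
      show "card (A - X) < card A" using tight less.prems(1)
        by (intro psubset_card_mono) auto
      show "finite (A - X)" "finite E'" using less.prems by (auto simp: E'_def)
      fix Y assume Y: "Y \<subseteq> A - X"
      have fY: "finite Y" using Y less.prems(1) finite_subset by blast
      have "card X + card Y = card (X \<union> Y)"
        using Y fX fY by (intro card_Un_disjoint[symmetric]) auto
      also have "\<dots> \<le> card (E `` (X \<union> Y))"
        using less.prems(3)[of "X \<union> Y"] Y tight(1) by blast
      also have "E `` (X \<union> Y) = E `` X \<union> E' `` Y" by (auto simp: E'_def)
      also have "card \<dots> \<le> card (E `` X) + card (E' `` Y)" by (rule card_Un_le)
      finally show "card Y \<le> card (E' `` Y)" using tight(4) by simp
    qed
    then obtain g where g: "inj_on g (A - X)" "\<forall>x\<in>A - X. (x, g x) \<in> E'" by blast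
    let ?h = "\<lambda>x. if x \<in> X then f x else g x"
    have "f x \<in> E `` X" if "x \<in> X" for x using f(2) that by blast
    moreover have "g x \<notin> E `` X" if "x \<in> A - X" for x using bspec[OF g(2) that] by (simp add: E'_def)
    ultimately have "inj_on ?h A"
      using f(1) g(1) unfolding inj_on_def by (metis DiffI)
    moreover have "\<forall>x\<in>A. (x, ?h x) \<in> E"
      using f(2) g(2) unfolding E'_def by simp
    ultimately show ?thesis by blast
  qed simp
qed

text \<open>The last hypothesis says that every nonempty induced subgraph has a vertex of degree at
  most one, that is, that the graph is a forest. Stripping such vertices one at a time removes at
  most one edge per vertex, and the last vertex carries none.\<close>

lemma forest_card_less:
  assumes "finite A" "finite B" "A \<noteq> {} \<or> B \<noteq> {}"
    and "\<And>A' B'. A' \<subseteq> A \<Longrightarrow> B' \<subseteq> B \<Longrightarrow> A' \<noteq> {} \<or> B' \<noteq> {} \<Longrightarrow>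
      (\<exists>a\<in>A'. card (E `` {a} \<inter> B') \<le> 1) \<or> (\<exists>b\<in>B'. card (E\<inverse> `` {b} \<inter> A') \<le> 1)"
  shows "card (E \<inter> A \<times> B) < card A + card B"
  using assms
proof (induction "card A + card B" arbitrary: A B rule: less_induct)
  case less
  note fin = less.prems(1,2)
  have leaf: "card (E \<inter> A \<times> B) < card A + card B"
    if sub: "A' \<subseteq> A" "B' \<subseteq> B" and sz: "card A' + card B' + 1 = card A + card B"
      and eq: "E \<inter> A \<times> B = E \<inter> A' \<times> B' \<union> S" and S: "card S \<le> 1" for A' B' S
  proof (cases "A' = {} \<and> B' = {}")
    case True
    then have "card A = 0 \<or> card B = 0" using sz by auto
    then have "E \<inter> A \<times> B = {}" using fin by auto
    then have "card (E \<inter> A \<times> B) = 0" by simp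
    then show ?thesis using sz by linarith
  next
    case False
    have "card (E \<inter> A' \<times> B') < card A' + card B'"
      using less.hyps[of A' B'] less.prems(4) sub sz False finite_subset[OF _ fin(1)] finite_subset[OF _ fin(2)]
      by (smt (verit) less_add_one subset_trans)
    moreover have "card (E \<inter> A \<times> B) \<le> card (E \<inter> A' \<times> B') + card S"
      unfolding eq by (rule card_Un_le)
    ultimately show ?thesis using sz S by linarith
  qed
  from less.prems(4)[OF subset_refl subset_refl less.prems(3)] show ?case
  proof
    assume "\<exists>a\<in>A. card (E `` {a} \<inter> B) \<le> 1"
    then obtain a where a: "a \<in> A" "card (E `` {a} \<inter> B) \<le> 1" by blast
    show ?thesis
    proof (rule leaf)
      show "card (A - {a}) + card B + 1 = card A + card B"
        using a(1) fin(1) card_Suc_Diff1[of A a] by simp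
      show "E \<inter> A \<times> B = E \<inter> (A - {a}) \<times> B \<union> Pair a ` (E `` {a} \<inter> B)"
        using a by auto
      show "card (Pair a ` (E `` {a} \<inter> B)) \<le> 1"
        using a(2) by (simp add: card_image inj_on_def)
    qed auto
  next
    assume "\<exists>b\<in>B. card (E\<inverse> `` {b} \<inter> A) \<le> 1"
    then obtain b where b: "b \<in> B" "card (E\<inverse> `` {b} \<inter> A) \<le> 1" by blast
    show ?thesis
    proof (rule leaf)
      show "card A + card (B - {b}) + 1 = card A + card B"
        using b(1) fin(2) card_Suc_Diff1[of B b] by simp
      show "E \<inter> A \<times> B = E \<inter> A \<times> (B - {b}) \<union> (\<lambda>a. (a, b)) ` (E\<inverse> `` {b} \<inter> A)"
        using b by auto
      show "card ((\<lambda>a. (a, b)) ` (E\<inverse> `` {b} \<inter> A)) \<le> 1"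
        using b(2) by (simp add: card_image inj_on_def)
    qed auto
  qed
qed

lemma two_distinct_elements:
  assumes "\<not> card S \<le> 1"
  obtains x y where "x \<in> S" "y \<in> S" "x \<noteq> y"
proof -
  have "finite S" using assms by (metis card.infinite le_numeral_extra(3) nat_le_linear zero_le_one)
  then show thesis using assms that card_le_Suc0_iff_eq[of S] by auto
qed

lemma ex_other_element:
  assumes "\<not> card S \<le> 1"
  shows "\<exists>y\<in>S. y \<noteq> x"
  using two_distinct_elements[OF assms] by metis

subsection \<open>Vertices of degree two in one colour class\<close>

text \<open>The single condition \<open>card X < card (E `` X)\<close> for all nonempty proper subsets of one
  colour class encodes that the bipartite graph \<open>E\<close> is matching covered; \<open>critical\<close> encodes
  minimality: deleting the edge \<open>(a, b)\<close> destroys the condition at the set \<open>X\<close>.\<close>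

locale minimal_surplus =
  fixes A :: "'a set" and B :: "'b set" and E :: "('a \<times> 'b) set"
  assumes fin_A: "finite A" and fin_B: "finite B" and E_sub: "E \<subseteq> A \<times> B"
    and card_eq: "card A = card B" and card_A: "2 \<le> card A"
    and surplus: "X \<subseteq> A \<Longrightarrow> X \<noteq> {} \<Longrightarrow> X \<noteq> A \<Longrightarrow> card X < card (E `` X)"
    and critical: "(a, b) \<in> E \<Longrightarrow>
      \<exists>X\<subseteq>A. X \<noteq> A \<and> X \<inter> E\<inverse> `` {b} = {a} \<and> card (E `` X) = Suc (card X)"
begin

definition tight :: "'a set \<Rightarrow> 'a \<Rightarrow> 'b \<Rightarrow> bool" where
  "tight X a b \<longleftrightarrow> X \<subseteq> A \<and> X \<noteq> A \<and> X \<inter> E\<inverse> `` {b} = {a} \<and> card (E `` X) = Suc (card X)"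

lemma ex_tight: "(a, b) \<in> E \<Longrightarrow> \<exists>X. tight X a b"
  using critical unfolding tight_def by blast

lemma tightD:
  assumes "tight X a b"
  shows "X \<subseteq> A" "X \<noteq> A" "a \<in> X" "(a, b) \<in> E" "card (E `` X) = Suc (card X)"
    "x \<in> X \<Longrightarrow> (x, b) \<in> E \<Longrightarrow> x = a"
  using assms unfolding tight_def by blast+

lemma fin_E: "finite E"
  using E_sub fin_A fin_B finite_subset by blast

lemma fin_Image: "finite (E `` X)"
  using fin_E by (rule finite_Image)

lemma fin_sub: "X \<subseteq> A \<Longrightarrow> finite X"
  using fin_A finite_subset by blast

lemma submodular:
  "card (E `` (X \<union> Y)) + card (E `` X \<inter> E `` Y) = card (E `` X) + card (E `` Y)"
  using card_Un_Int[OF fin_Image fin_Image, of X Y] by (simp add: Image_Un)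

text \<open>The vertex \<open>b\<close> is a common neighbour of \<open>X\<close> and
  \<open>X'\<close>, yet none of their intersection, because its only neighbours in the two sets
  differ. If the sets met, submodularity would therefore gain one and leave their union without
  surplus. So the union would be \<open>A\<close>, and \<open>b\<close> would have no neighbours
  besides \<open>a\<close> and \<open>a'\<close>.\<close>

lemma tight_disjoint:
  assumes "tight X a b" "tight X' a' b" "a' \<noteq> a" "\<not> E\<inverse> `` {b} \<subseteq> {a, a'}"
  shows "X \<inter> X' = {}"
proof (rule ccontr)
  assume ne: "X \<inter> X' \<noteq> {}"
  note X = tightD[OF assms(1)] and X' = tightD[OF assms(2)]
  have sub: "X \<inter> X' \<subseteq> A" "X \<union> X' \<subseteq> A" using X(1-3) X'(1-3) by blast+
  have "X \<inter> X' \<noteq> A" using X(1-3) X'(1-3) by blast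
  then have "card (X \<inter> X') < card (E `` (X \<inter> X'))" using surplus ne sub by blast
  moreover have "E `` (X \<inter> X') \<subset> E `` X \<inter> E `` X'"
  proof
    have "b \<in> E `` X \<inter> E `` X'" using X(3,4) X'(3,4) by blast
    moreover have "b \<notin> E `` (X \<inter> X')" using X(6) X'(6) assms(3) by blast
    ultimately show "E `` (X \<inter> X') \<noteq> E `` X \<inter> E `` X'" by blast
  qed blast
  then have "card (E `` (X \<inter> X')) < card (E `` X \<inter> E `` X')"
    using fin_Image by (intro psubset_card_mono) auto
  moreover have "card (X \<union> X') + card (X \<inter> X') = card X + card X'"
    using card_Un_Int[OF fin_sub fin_sub] X(1) X'(1) by metis
  ultimately have "card (E `` (X \<union> X')) \<le> card (X \<union> X')"
    using submodular[of X X'] X(5) X'(5) by linarith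
  then have "X \<union> X' = A" using surplus[of "X \<union> X'"] sub ne by fastforce
  then have "E\<inverse> `` {b} \<subseteq> {a, a'}" using X(6) X'(6) E_sub by blast
  then show False using assms(4) by blast
qed

text \<open>If the union were proper, submodularity would give the intersection surplus exactly one.
  As \<open>a\<close> does not have degree two, the intersection is more than \<open>{a}\<close>;
  but dropping \<open>a\<close> from it loses both \<open>b\<close> and \<open>b'\<close> as
  neighbours, which contradicts the surplus condition.\<close>

lemma tight_cover:
  assumes "tight X a b" "tight X' a b'" "b \<noteq> b'" "card (E `` {a}) \<noteq> 2"
  shows "X \<union> X' = A"
proof (rule ccontr)
  assume ne: "X \<union> X' \<noteq> A"
  note X = tightD[OF assms(1)] and X' = tightD[OF assms(2)]
  let ?I = "X \<inter> X'"
  have sub: "?I \<subseteq> A" "X \<union> X' \<subseteq> A" and aI: "a \<in> ?I" using X(1-3) X'(1-3) by blast+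
  have fI: "finite ?I" using sub fin_sub by blast
  have "card (X \<union> X') < card (E `` (X \<union> X'))" using surplus ne sub aI by blast
  moreover have "card (X \<union> X') + card ?I = card X + card X'"
    using card_Un_Int[OF fin_sub fin_sub] X(1) X'(1) by metis
  moreover have "card (E `` ?I) \<le> card (E `` X \<inter> E `` X')"
    using fin_Image by (intro card_mono) auto
  ultimately have I: "card (E `` ?I) \<le> Suc (card ?I)"
    using submodular[of X X'] X(5) X'(5) by linarith
  have IA: "?I \<noteq> A" using X(1,2) by blast
  have "card (?I) < card (E `` ?I)" using surplus[OF sub(1) _ IA] aI by blast
  then have I': "card (E `` ?I) = Suc (card ?I)" using I by simp
  show False
  proof (cases "?I = {a}")
    case True
    then show False using I' assms(4) by simp
  next
    case False
    have "card (?I - {a}) < card (E `` (?I - {a}))"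
      using surplus[of "?I - {a}"] sub(1) aI IA False by blast
    \<comment> \<open>Within \<open>X\<close> only \<open>a\<close> is adjacent to \<open>b\<close>,
      and within \<open>X'\<close> only \<open>a\<close> is adjacent to \<open>b'\<close>, so
      neither survives in the neighbourhood.\<close>
    also have "\<dots> \<le> card (E `` ?I - {b, b'})"
      using X(6) X'(6) fin_Image by (intro card_mono) auto
    also have "\<dots> = card ?I - 1"
      using aI X(4) X'(4) assms(3) I' by (subst card_Diff_subset) auto
    also have "\<dots> = card (?I - {a})" using aI fI by simp
    finally show False by simp
  qed
qed

lemma tight_singleton:
  assumes "(a, b) \<in> E" "card (E `` {a}) = 2"
  shows "tight {a} a b"
proof -
  have "{a} \<noteq> A" using card_A by auto
  then show ?thesis using assms E_sub unfolding tight_def by auto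
qed

text \<open>In a set of vertices inducing minimum degree two, a tight set \<open>X\<close> for an edge \<open>ab\<close>
  could be enlarged: walk on to a neighbour \<open>a'\<close> of \<open>b\<close> and a further neighbour \<open>b'\<close> of
  \<open>a'\<close>. The tight sets of \<open>ba'\<close> and \<open>a'b'\<close> cover \<open>A\<close> and the former misses \<open>X\<close>,
  so the latter properly contains \<open>X\<close>.\<close>

lemma degree_at_least_three_leaf:
  assumes no_isolated: "\<And>b. b \<in> B \<Longrightarrow> card (E\<inverse> `` {b}) = 2 \<Longrightarrow> \<exists>a\<in>E\<inverse> `` {b}. card (E `` {a}) = 2"
    and A': "A' \<subseteq> A" "\<And>a. a \<in> A' \<Longrightarrow> card (E `` {a}) = 2 \<Longrightarrow> a = a0"
    and B': "B' \<subseteq> B" and ne: "A' \<noteq> {} \<or> B' \<noteq> {}"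
  shows "(\<exists>a\<in>A'. card (E `` {a} \<inter> B') \<le> 1) \<or> (\<exists>b\<in>B'. card (E\<inverse> `` {b} \<inter> A') \<le> 1)"
proof (rule ccontr)
  assume "\<not> ?thesis"
  then have nA: "\<And>a. a \<in> A' \<Longrightarrow> \<not> card (E `` {a} \<inter> B') \<le> 1"
    and nB: "\<And>b. b \<in> B' \<Longrightarrow> \<not> card (E\<inverse> `` {b} \<inter> A') \<le> 1" by blast+
  have nextA: "\<exists>a'\<in>A'. (a', b) \<in> E \<and> a' \<noteq> a" if "b \<in> B'" for a b
    using ex_other_element[OF nB[OF that], of a] by blast
  have nextB: "\<exists>b'\<in>B'. (a, b') \<in> E \<and> b' \<noteq> b" if "a \<in> A'" for a b
    using ex_other_element[OF nA[OF that], of b] by blast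
  have degA: "card (E `` {a}) \<ge> 2" if "a \<in> A'" for a
  proof -
    have "card (E `` {a} \<inter> B') \<le> card (E `` {a})" using fin_Image by (intro card_mono) auto
    then show ?thesis using nA[OF that] by simp
  qed
  \<comment> \<open>The sets among which a largest one is taken. Containing \<open>a0\<close>
    ensures that a vertex of \<open>A'\<close> outside \<open>X\<close> does not have degree two;
    being \<open>{a}\<close> when \<open>a\<close> has degree two makes \<open>X\<close> trivially
    disjoint from the next tight set.\<close>
  define good where "good X \<longleftrightarrow> (\<exists>a b. tight X a b \<and> a \<in> A' \<and> b \<in> B' \<and>
      (a0 \<in> A' \<longrightarrow> a0 \<in> X) \<and> (card (E `` {a}) = 2 \<longrightarrow> X = {a}))" for X
  have "\<exists>X. good X"
  proof (cases "a0 \<in> A'")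
    case True
    then obtain b where b: "b \<in> B'" "(a0, b) \<in> E" using nextB by blast
    show ?thesis
    proof (cases "card (E `` {a0}) = 2")
      case True
      then show ?thesis using tight_singleton b \<open>a0 \<in> A'\<close> unfolding good_def by blast
    next
      case False
      obtain X where "tight X a0 b" using ex_tight b by blast
      then show ?thesis using b \<open>a0 \<in> A'\<close> False tightD(3) unfolding good_def by blast
    qed
  next
    case False
    obtain a b where ab: "a \<in> A'" "b \<in> B'" "(a, b) \<in> E" using ne nextA nextB by (metis ex_in_conv)
    obtain X where "tight X a b" using ex_tight ab by blast
    then show ?thesis using ab False A'(2) unfolding good_def by blast
  qed
  then obtain X0 where "good X0" ..
  moreover have "\<forall>Y. good Y \<longrightarrow> card Y < Suc (card A)"
    using fin_A unfolding good_def by (meson card_mono le_imp_less_Suc tightD(1))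
  ultimately obtain X where X: "good X" and max: "\<And>Y. good Y \<Longrightarrow> card Y \<le> card X"
    using ex_has_greatest_nat[of good X0 card "Suc (card A)"] by metis
  from X obtain a b where ab: "tight X a b" "a \<in> A'" "b \<in> B'" "a0 \<in> A' \<Longrightarrow> a0 \<in> X"
    "card (E `` {a}) = 2 \<Longrightarrow> X = {a}" unfolding good_def by blast
  obtain a' where a': "a' \<in> A'" "(a', b) \<in> E" "a' \<noteq> a" using nextA ab by blast
  obtain b' where b': "b' \<in> B'" "(a', b') \<in> E" "b' \<noteq> b" using nextB a' by blast
  have a'X: "a' \<notin> X" using tightD(6)[OF ab(1)] a' by blast
  then have "a' \<noteq> a0" using ab(4) a'(1) by blast
  then have deg: "card (E `` {a'}) \<noteq> 2" using A'(2) a' by blast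
  obtain X' where X': "tight X' a' b" using ex_tight a' by blast
  obtain X'' where X'': "tight X'' a' b'" using ex_tight b' by blast
  have "X \<inter> X' = {}"
  proof (cases "card (E `` {a}) = 2")
    case True
    then show ?thesis using ab(5) tightD(4)[OF ab(1)] tightD(6)[OF X'] a'(3) by blast
  next
    case False
    \<comment> \<open>The only use of \<open>no_isolated\<close>: were \<open>a\<close> and
      \<open>a'\<close> all the neighbours of \<open>b\<close>, then \<open>b\<close> would have
      degree two with no neighbour of degree two.\<close>
    have "\<not> E\<inverse> `` {b} \<subseteq> {a, a'}"
    proof
      assume "E\<inverse> `` {b} \<subseteq> {a, a'}"
      then have eq: "E\<inverse> `` {b} = {a, a'}" using tightD(4)[OF ab(1)] a'(2) by blast
      then show False using no_isolated[of b] B' ab(3) a'(3) False deg by auto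
    qed
    then show ?thesis using tight_disjoint ab(1) X' a'(3) by blast
  qed
  moreover have "X' \<union> X'' = A" using tight_cover X' X'' b'(3) deg by blast
  \<comment> \<open>\<open>X\<close> misses \<open>X'\<close>, so it lies in \<open>X''\<close>; the
    inclusion is proper because of \<open>a'\<close>.\<close>
  ultimately have sub: "X \<subset> X''" using tightD(1)[OF ab(1)] tightD(3)[OF X''] a'X by blast
  then have "good X''" using X'' a' b' ab(4) deg unfolding good_def by blast
  then show False using max sub psubset_card_mono[OF fin_sub[OF tightD(1)[OF X'']] sub] by fastforce
qed

lemma card_E: "card E = (\<Sum>a\<in>A. card (E `` {a}))"
proof -
  have "E = (SIGMA a:A. E `` {a})" using E_sub by auto
  then show ?thesis using fin_A fin_Image by (metis card_SigmaI)
qed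

text \<open>Let \<open>A\<close> contain \<open>k\<close> > 0 vertices of degree two. Removing
  \<open>k - 1\<close> of them removes 2(\<open>k\<close> - 1) edges and leaves a forest on
  2|\<open>A\<close>| - (\<open>k\<close> - 1) vertices, which has fewer edges than
  vertices.\<close>

lemma card_degree_two:
  assumes no_isolated: "\<And>b. b \<in> B \<Longrightarrow> card (E\<inverse> `` {b}) = 2 \<Longrightarrow> \<exists>a\<in>E\<inverse> `` {b}. card (E `` {a}) = 2"
  shows "card E + 2 \<le> 2 * card A + card {a \<in> A. card (E `` {a}) = 2}"
proof -
  let ?A2 = "{a \<in> A. card (E `` {a}) = 2}"
  have fA2: "finite ?A2" using fin_A by simp
  have deg: "card (E `` {a}) \<ge> 2" if "a \<in> A" for a
    using surplus[of "{a}"] that card_A by fastforce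
  have bound: "card (E \<inter> A' \<times> B) < card A' + card B"
    if "A' \<subseteq> A" "\<And>a. a \<in> A' \<Longrightarrow> card (E `` {a}) = 2 \<Longrightarrow> a = a0" for A' a0
  proof (rule forest_card_less)
    show "finite A'" using that(1) fin_sub by blast
    show "A' \<noteq> {} \<or> B \<noteq> {}" using card_eq card_A by auto
    fix C D assume "C \<subseteq> A'" "D \<subseteq> B" "C \<noteq> {} \<or> D \<noteq> {}"
    then show "(\<exists>a\<in>C. card (E `` {a} \<inter> D) \<le> 1) \<or> (\<exists>b\<in>D. card (E\<inverse> `` {b} \<inter> C) \<le> 1)"
      using that by (intro degree_at_least_three_leaf[OF no_isolated, of _ a0]) auto
  qed (rule fin_B)
  have split: "card (E \<inter> (A - S) \<times> B) + 2 * card S = card E" if "S \<subseteq> ?A2" for S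
  proof -
    have "E \<inter> (A - S) \<times> B = (SIGMA a:A - S. E `` {a})" using E_sub by auto
    then have "card (E \<inter> (A - S) \<times> B) = (\<Sum>a\<in>A - S. card (E `` {a}))"
      using fin_A fin_Image by simp
    moreover have "(\<Sum>a\<in>S. card (E `` {a})) = 2 * card S"
      using that by (simp add: subset_iff)
    moreover have "S \<subseteq> A" using that by blast
    ultimately show ?thesis
      using card_E sum.subset_diff[of S A "\<lambda>a. card (E `` {a})"] fin_A by simp
  qed
  show ?thesis
  proof (cases "?A2 = {}")
    case True
    \<comment> \<open>This case is contradictory: minimum degree three gives at least
      \<open>3 * card A\<close> edges, while a forest has fewer than
      \<open>2 * card A\<close>.\<close>
    then have "\<And>a. a \<in> A \<Longrightarrow> card (E `` {a}) \<ge> 3" using deg by fastforce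
    then have "card E \<ge> 3 * card A"
      using card_E sum_bounded_below[of A 3 "\<lambda>a. card (E `` {a})"] by simp
    moreover have "card E < card A + card B"
      using bound[of A] True E_sub by (auto simp: Int_absorb2)
    ultimately show ?thesis using card_eq by linarith
  next
    case False
    then obtain a0 where a0: "a0 \<in> ?A2" by blast
    let ?S = "?A2 - {a0}"
    have S: "?S \<subseteq> ?A2" "?S \<subseteq> A" "finite ?S" "card ?S + 1 = card ?A2"
      using a0 fA2 card_Suc_Diff1[of ?A2 a0] by auto
    have "card (E \<inter> (A - ?S) \<times> B) < card (A - ?S) + card B"
      using bound[of "A - ?S" a0] by blast
    moreover have "card (A - ?S) + card ?S = card A"
      using card_Diff_subset[OF S(3,2)] card_mono[OF fin_A S(2)] by linarith
    ultimately show ?thesis using split[OF S(1)] S(4) card_eq by linarith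
  qed
qed

end

subsection \<open>Bipartite matching covered graphs\<close>

definition bipartition :: "('v, 'e) mgraph \<Rightarrow> 'v set \<Rightarrow> 'v set \<Rightarrow> bool" where
  "bipartition G A B \<longleftrightarrow> A \<union> B = verts G \<and> A \<inter> B = {} \<and>
     (\<forall>e\<in>edges G. ends G e \<inter> A \<noteq> {} \<and> ends G e \<inter> B \<noteq> {})"

lemma bipartite_iff: "bipartite G \<longleftrightarrow> (\<exists>A B. bipartition G A B)"
  unfolding bipartite_def bipartition_def by blast

text \<open>The edges directed out of \<open>A\<close>, with parallel edges merged. For minimal
  graphs the merging loses nothing, as these turn out to be simple.\<close>

definition adj :: "('v, 'e) mgraph \<Rightarrow> 'v set \<Rightarrow> ('v \<times> 'v) set" where
  "adj G A = {(a, b). a \<in> A \<and> b \<in> neighbours G a}"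

lemma neighbours_sym: "w \<in> neighbours G v \<longleftrightarrow> v \<in> neighbours G w"
  unfolding neighbours_def by (auto simp: insert_commute)

definition surplus :: "'a set \<Rightarrow> ('a \<times> 'b) set \<Rightarrow> bool" where
  "surplus A E \<longleftrightarrow> (\<forall>X\<subseteq>A. X \<noteq> {} \<longrightarrow> X \<noteq> A \<longrightarrow> card X < card (E `` X))"

lemma degree_loopless:
  assumes "graph G"
  shows "degree G v = card {e \<in> edges G. v \<in> ends G e}"
proof -
  have no: "{e \<in> edges G. ends G e = {v}} = {}" using assms unfolding graph_def by fastforce
  show ?thesis unfolding degree_def no by simp
qed

locale bipartite_graph =
  fixes G :: "('v, 'e) mgraph" and A B :: "'v set"
  assumes graph: "graph G" and bipartition: "bipartition G A B"
begin

text \<open>Through this symmetry every result about \<open>A\<close> is also available for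
  \<open>B\<close>.\<close>

lemma swap: "bipartite_graph G B A"
  using graph bipartition unfolding bipartite_graph_def bipartition_def by blast

lemma verts_eq: "verts G = A \<union> B" and disjoint: "A \<inter> B = {}"
  using bipartition unfolding bipartition_def by auto

lemma fin: "finite A" "finite B" "finite (edges G)"
  using graph verts_eq unfolding graph_def by auto

lemma card_verts: "card (verts G) = card A + card B"
  unfolding verts_eq using fin disjoint by (simp add: card_Un_disjoint)

lemma edge_ends:
  assumes "e \<in> edges G"
  obtains a b where "a \<in> A" "b \<in> B" "ends G e = {a, b}"
proof -
  obtain a b where ab: "a \<in> A" "b \<in> B" "{a, b} \<subseteq> ends G e"
    using assms bipartition unfolding bipartition_def by blast
  have "card (ends G e) = 2" using assms graph unfolding graph_def by blast
  moreover have "a \<noteq> b" using ab disjoint by blast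
  then have "card {a, b} = 2" by simp
  ultimately have "ends G e = {a, b}" using ab(3)
    by (metis card.infinite card_subset_eq zero_neq_numeral)
  then show thesis using ab that by blast
qed

lemma pair_end:
  assumes "a \<in> A" "b \<in> B" "x \<in> {a, b}"
  shows "x \<in> A \<Longrightarrow> x = a" "x \<in> B \<Longrightarrow> x = b"
  using assms disjoint by blast+

lemma adj_iff: "(a, b) \<in> adj G A \<longleftrightarrow> a \<in> A \<and> b \<in> B \<and> (\<exists>e\<in>edges G. ends G e = {a, b})"
proof -
  have "b \<in> B" if "a \<in> A" "e \<in> edges G" "ends G e = {a, b}" for e
    using edge_ends[OF that(2)] that disjoint by (metis disjoint_iff doubleton_eq_iff)
  then show ?thesis unfolding adj_def neighbours_def by blast
qed

lemma adj_subset: "adj G A \<subseteq> A \<times> B"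
  using adj_iff by auto

lemma adj_converse: "(adj G A)\<inverse> = adj G B"
  using adj_iff bipartite_graph.adj_iff[OF swap] by (auto simp: insert_commute)

lemma adj_singleton: "a \<in> A \<Longrightarrow> adj G A `` {a} = neighbours G a"
  unfolding adj_def by auto

lemma neighbours_subset: "a \<in> A \<Longrightarrow> neighbours G a \<subseteq> B"
  using adj_subset adj_singleton by blast

lemma finite_adj: "finite (adj G A)"
  using adj_subset fin finite_subset by blast

lemma neighbours_finite: "finite (neighbours G v)"
proof -
  have "neighbours G v \<subseteq> \<Union> (ends G ` edges G)" unfolding neighbours_def by auto
  moreover have "finite (\<Union> (ends G ` edges G))"
    using graph fin(3) unfolding graph_def by (auto intro: finite_subset)
  ultimately show ?thesis by (rule finite_subset)
qed

text \<open>Mapping each vertex of \<open>A\<close> to the other end of its matching edge is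
  injective because matching edges do not share ends in \<open>B\<close>, and surjective because
  they cover \<open>B\<close>.\<close>

lemma perfect_matching_bij:
  assumes "perfect_matching G M"
  obtains g where "bij_betw g A B"
    "\<And>e a b. e \<in> M \<Longrightarrow> ends G e = {a, b} \<Longrightarrow> a \<in> A \<Longrightarrow> b = g a"
    "\<And>a. a \<in> A \<Longrightarrow> g a \<in> neighbours G a"
proof -
  have M: "M \<subseteq> edges G" "\<And>v. v \<in> A \<union> B \<Longrightarrow> \<exists>!e. e \<in> M \<and> v \<in> ends G e"
    using assms verts_eq unfolding perfect_matching_def by auto
  have "\<exists>b e. e \<in> M \<and> ends G e = {a, b} \<and> b \<in> B" if a: "a \<in> A" for a
  proof -
    obtain e where e: "e \<in> M" "a \<in> ends G e" using M(2)[of a] a by blast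
    obtain a' b where ab: "a' \<in> A" "b \<in> B" "ends G e = {a', b}" using edge_ends e(1) M(1) by blast
    have "a = a'" using pair_end(1)[OF ab(1,2)] e(2) a ab(3) by simp
    then show ?thesis using e(1) ab by blast
  qed
  then obtain g m where g: "\<And>a. a \<in> A \<Longrightarrow> m a \<in> M \<and> ends G (m a) = {a, g a} \<and> g a \<in> B"
    by metis
  have uniq: "b = g a" if "e \<in> M" "ends G e = {a, b}" "a \<in> A" for e a b
  proof -
    have "e = m a" using M(2)[of a] g[of a] that by auto
    then show ?thesis using g[of a] that by (metis doubleton_eq_iff)
  qed
  have "inj_on g A"
  proof (rule inj_onI)
    fix a a' assume a: "a \<in> A" "a' \<in> A" "g a = g a'"
    then have "m a = m a'" using M(2)[of "g a"] g[of a] g[of a'] by auto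
    then show "a = a'" using g[of a] g[of a'] a by (metis doubleton_eq_iff)
  qed
  moreover have "b \<in> g ` A" if b: "b \<in> B" for b
  proof -
    obtain e where e: "e \<in> M" "b \<in> ends G e" using M(2) b by blast
    obtain a b' where ab: "a \<in> A" "b' \<in> B" "ends G e = {a, b'}" using edge_ends e(1) M(1) by blast
    have "b = b'" using pair_end(2)[OF ab(1,2)] e(2) b ab(3) by simp
    then show ?thesis using uniq[OF e(1) ab(3,1)] ab by blast
  qed
  ultimately have "bij_betw g A B" using g unfolding bij_betw_def by blast
  moreover have "g a \<in> neighbours G a" if "a \<in> A" for a
    using g[OF that] M(1) unfolding neighbours_def by blast
  ultimately show thesis using that uniq by blast
qed

text \<open>A perfect matching sends \<open>X\<close> injectively into its neighbourhood N(X). If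
  N(X) were no larger than \<open>X\<close>, every perfect matching would use up N(X) on
  \<open>X\<close>; but by connectedness some edge joins N(X) to a vertex of \<open>A\<close>
  outside \<open>X\<close>, and that edge lies in a perfect matching.\<close>

lemma matching_covered_imp_surplus:
  assumes "matching_covered G"
  shows "card A = card B \<and> 2 \<le> card A \<and> surplus A (adj G A)"
proof -
  have conn: "connected_graph G" and four: "4 \<le> card (verts G)"
    and cov: "\<And>e. e \<in> edges G \<Longrightarrow> \<exists>M. perfect_matching G M \<and> e \<in> M"
    using assms unfolding matching_covered_def by auto
  \<comment> \<open>Connectedness in terms of cuts: an edge leaves every vertex set that is nonempty
    and not everything.\<close>
  have crossing: "\<exists>e\<in>edges G. \<exists>x\<in>S. \<exists>y. y \<notin> S \<and> ends G e = {x, y}"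
    if S: "s \<in> S" "S \<subseteq> verts G" "t \<in> verts G" "t \<notin> S" for S s t
  proof (rule ccontr)
    assume nc: "\<not> ?thesis"
    have "(\<lambda>x y. y \<in> neighbours G x)\<^sup>*\<^sup>* s t"
      using conn S unfolding connected_graph_def by blast
    then have "t \<in> S"
    proof induction
      case (step y z)
      then show ?case using nc unfolding neighbours_def by blast
    qed (rule S(1))
    then show False using S by blast
  qed
  obtain s where s: "s \<in> verts G" using four by fastforce
  have "verts G \<noteq> {s}" using four by auto
  then obtain t where "t \<in> verts G" "t \<notin> {s}" using s by blast
  then obtain e where "e \<in> edges G" using crossing[of s "{s}" t] s by blast
  then obtain M where M: "perfect_matching G M" using cov by blast
  obtain g0 where "bij_betw g0 A B" by (rule perfect_matching_bij[OF M])
  then have eq: "card A = card B" by (rule bij_betw_same_card)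
  moreover have "2 \<le> card A" using four card_verts eq by linarith
  moreover have "card X < card (adj G A `` X)" if X: "X \<subseteq> A" "X \<noteq> {}" "X \<noteq> A" for X
  proof (rule ccontr)
    let ?N = "adj G A `` X"
    assume "\<not> card X < card ?N"
    then have le: "card ?N \<le> card X" by simp
    obtain s t where st: "s \<in> X" "t \<in> A" "t \<notin> X" using X by blast
    have tN: "t \<notin> X \<union> ?N" using st adj_subset disjoint by blast
    have sub: "X \<union> ?N \<subseteq> verts G" using X adj_subset verts_eq by blast
    obtain f x y where f: "f \<in> edges G" "x \<in> X \<union> ?N" "y \<notin> X \<union> ?N" "ends G f = {x, y}"
      using crossing[of s "X \<union> ?N" t] st tN sub verts_eq by blast
    \<comment> \<open>Edges from \<open>X\<close> end in \<open>?N\<close>, so \<open>f\<close>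
      leaves the set from its part in \<open>B\<close>, and its other end lies in \<open>A\<close>
      outside \<open>X\<close>.\<close>
    have "x \<notin> X" using f X unfolding adj_def neighbours_def by blast
    then have x: "x \<in> ?N" "x \<in> B" using f adj_subset by blast+
    then have y: "y \<in> A" using edge_ends[OF f(1)] f(4) disjoint by (metis disjoint_iff doubleton_eq_iff)
    obtain M where M: "perfect_matching G M" "f \<in> M" using cov f by blast
    obtain g where g: "bij_betw g A B"
      "\<And>e a b. e \<in> M \<Longrightarrow> ends G e = {a, b} \<Longrightarrow> a \<in> A \<Longrightarrow> b = g a"
      "\<And>a. a \<in> A \<Longrightarrow> g a \<in> neighbours G a" by (rule perfect_matching_bij[OF M(1)]) (rule that)
    have inj: "inj_on g A" using g(1) unfolding bij_betw_def by blast
    have "g ` X \<subseteq> ?N" using g(3) X(1) unfolding adj_def by blast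
    moreover have "card (g ` X) = card X" using inj X(1) by (meson card_image inj_on_subset)
    ultimately have "g ` X = ?N"
      using le finite_adj by (intro card_seteq) auto
    then have "x \<in> g ` X" using x(1) by (simp only:)
    then obtain x' where x': "x = g x'" "x' \<in> X" by (rule imageE)
    have "x = g y" using g(2)[OF M(2), of y x] f(4) y by (simp add: insert_commute)
    then have "x' = y" using inj_onD[OF inj, of x' y] x' X(1) y by (simp add: subset_iff)
    then show False using x'(2) f(3) by blast
  qed
  ultimately show ?thesis unfolding surplus_def by blast
qed

lemma perfect_matching_of_bij:
  assumes "bij_betw h A B" and "\<And>a. a \<in> A \<Longrightarrow> m a \<in> edges G \<and> ends G (m a) = {a, h a}"
  shows "perfect_matching G (m ` A)"
proof -
  have hB: "h a \<in> B" if "a \<in> A" for a using assms(1) that unfolding bij_betw_def by blast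
  have "\<exists>!e. e \<in> m ` A \<and> v \<in> ends G e" if v: "v \<in> A \<union> B" for v
  proof (cases "v \<in> A")
    case True
    show ?thesis
    proof (rule ex1I[of _ "m v"])
      show "m v \<in> m ` A \<and> v \<in> ends G (m v)" using assms(2) True by blast
      show "e = m v" if e: "e \<in> m ` A \<and> v \<in> ends G e" for e
      proof -
        obtain a where a: "a \<in> A" "e = m a" using e by blast
        then have "v \<in> {a, h a}" using assms(2)[OF a(1)] e by simp
        then show ?thesis using pair_end(1)[OF a(1) hB[OF a(1)] _ True] a(2) by simp
      qed
    qed
  next
    case False
    then have vB: "v \<in> B" using v by blast
    then obtain a where a: "a \<in> A" "h a = v" using assms(1) unfolding bij_betw_def by blast
    have uniq: "x = a" if "x \<in> A" "h x = v" for x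
      using assms(1) a that unfolding bij_betw_def inj_on_def by blast
    show ?thesis
    proof (rule ex1I[of _ "m a"])
      show "m a \<in> m ` A \<and> v \<in> ends G (m a)" using assms(2) a by blast
      show "e = m a" if e: "e \<in> m ` A \<and> v \<in> ends G e" for e
      proof -
        obtain x where x: "x \<in> A" "e = m x" using e by blast
        then have "v \<in> {x, h x}" using assms(2)[OF x(1)] e by simp
        then show ?thesis using pair_end(2)[OF x(1) hB[OF x(1)] _ vB] uniq x by simp
      qed
    qed
  qed
  moreover have "m ` A \<subseteq> edges G" using assms(2) by auto
  ultimately show ?thesis unfolding perfect_matching_def verts_eq by simp
qed

text \<open>If a component missed part of \<open>A\<close>, the strict surplus inside and outside it
  would add up to |\<open>A\<close>| < |\<open>B\<close>|. For an edge \<open>ab\<close>, the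
  surplus makes up for the loss of \<open>b\<close>, so Hall's theorem matches the remaining
  vertices of \<open>A\<close> into \<open>B\<close> without \<open>b\<close>.\<close>

lemma surplus_imp_matching_covered:
  assumes eq: "card A = card B" and two: "2 \<le> card A" and sur: "surplus A (adj G A)"
  shows "matching_covered G"
proof -
  have sur: "card X < card (adj G A `` X)" if "X \<subseteq> A" "X \<noteq> {}" "X \<noteq> A" for X
    using sur that unfolding surplus_def by blast
  have finN: "finite (adj G A `` X)" for X using finite_adj by (rule finite_Image)
  \<comment> \<open>All but one vertex of \<open>A\<close> already have at least |\<open>A\<close>|
    = |\<open>B\<close>| neighbours.\<close>
  have full: "adj G A `` A = B"
  proof -
    obtain a where a: "a \<in> A" using two by fastforce
    have "A - {a} \<noteq> {}"
    proof
      assume "A - {a} = {}"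
      then have "A = {a}" using a by blast
      then show False using two by simp
    qed
    then have "card (A - {a}) < card (adj G A `` (A - {a}))" using sur[of "A - {a}"] a by blast
    also have "\<dots> \<le> card (adj G A `` A)" using finN by (intro card_mono) auto
    finally have "card B \<le> card (adj G A `` A)" using a eq fin(1) by simp
    then show ?thesis using adj_subset fin(2) by (intro card_seteq) auto
  qed
  have "(\<lambda>x y. y \<in> neighbours G x)\<^sup>*\<^sup>* u w" if uw: "u \<in> verts G" "w \<in> verts G" for u w
  proof -
    define R where "R = {x. (\<lambda>x y. y \<in> neighbours G x)\<^sup>*\<^sup>* u x}"
    have uR: "u \<in> R" unfolding R_def by simp
    have closed: "y \<in> R \<longleftrightarrow> x \<in> R" if "y \<in> neighbours G x" for x y
      using that neighbours_sym[of y G x] unfolding R_def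
      by (auto intro: rtranclp.rtrancl_into_rtrancl)
    have N1: "adj G A `` (R \<inter> A) \<subseteq> R \<inter> B" using closed adj_subset unfolding adj_def by blast
    have N2: "adj G A `` (A - R) \<subseteq> B - R" using closed adj_subset unfolding adj_def by blast
    have ne: "R \<inter> A \<noteq> {}"
    proof (cases "u \<in> A")
      case False
      then have "u \<in> adj G A `` A" using full uw verts_eq by blast
      then obtain a where "a \<in> A" "u \<in> neighbours G a" unfolding adj_def by blast
      then show ?thesis using closed uR by blast
    qed (use uR in blast)
    have "R \<inter> A = A"
    proof (rule ccontr)
      assume nA: "R \<inter> A \<noteq> A"
      have "card (R \<inter> A) < card (R \<inter> B)"
        using sur[OF _ ne nA] card_mono[OF _ N1] fin(2) by fastforce
      moreover have "card (A - R) < card (B - R)"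
        using sur[of "A - R"] ne nA card_mono[OF _ N2] fin(2) by fastforce
      moreover have "card (R \<inter> A) + card (A - R) = card A" "card (R \<inter> B) + card (B - R) = card B"
        using card_Int_Diff[OF fin(1), of R] card_Int_Diff[OF fin(2), of R]
        by (auto simp: Int_commute)
      ultimately show False using eq by linarith
    qed
    then have "A \<subseteq> R" "B \<subseteq> R" using N1 full by auto
    then show ?thesis using uw verts_eq unfolding R_def by blast
  qed
  moreover have "verts G \<noteq> {}" using two verts_eq by auto
  ultimately have "connected_graph G" unfolding connected_graph_def by blast
  moreover have "\<exists>M. perfect_matching G M \<and> f \<in> M" if f: "f \<in> edges G" for f
  proof -
    obtain a b where ab: "a \<in> A" "b \<in> B" "ends G f = {a, b}" using edge_ends f by blast
    define E where "E = adj G A - UNIV \<times> {b}"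
    have "\<exists>h. inj_on h (A - {a}) \<and> (\<forall>x\<in>A - {a}. (x, h x) \<in> E)"
    proof (rule hall_marriage)
      show "finite (A - {a})" "finite E" using fin finite_adj by (auto simp: E_def)
      fix X assume X: "X \<subseteq> A - {a}"
      have "E `` X = adj G A `` X - {b}" by (auto simp: E_def)
      moreover have "card X \<le> card (adj G A `` X - {b})"
      proof (cases "X = {}")
        case False
        then have "card X < card (adj G A `` X)" using sur[of X] X ab(1) by blast
        moreover have "card (adj G A `` X) \<le> Suc (card (adj G A `` X - {b}))"
          by (simp add: card_Diff_singleton_if) linarith
        ultimately show ?thesis by simp
      qed simp
      ultimately show "card X \<le> card (E `` X)" by simp
    qed
    then obtain h where h: "inj_on h (A - {a})" "\<And>x. x \<in> A - {a} \<Longrightarrow> (x, h x) \<in> adj G A \<and> h x \<noteq> b"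
      by (auto simp: E_def)
    define h' where "h' = h(a := b)"
    have inj: "inj_on h' A" using h unfolding h'_def inj_on_def by (auto simp: fun_upd_def)
    have h'adj: "(x, h' x) \<in> adj G A" if "x \<in> A" for x
      using h(2)[of x] that ab f adj_iff unfolding h'_def by auto
    have "h' ` A \<subseteq> B" using h'adj adj_subset by blast
    moreover have "card (h' ` A) = card B" using inj eq by (simp add: card_image)
    ultimately have bij: "bij_betw h' A B"
      using inj fin(2) card_subset_eq unfolding bij_betw_def by blast
    have "\<forall>x\<in>A. \<exists>e. e \<in> edges G \<and> ends G e = {x, h' x}" using h'adj adj_iff by blast
    then obtain m where m: "\<And>x. x \<in> A \<Longrightarrow> m x \<in> edges G \<and> ends G (m x) = {x, h' x}" by metis
    \<comment> \<open>The matching must contain \<open>f\<close> itself, whereas \<open>m\<close>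
      may have picked an edge parallel to it.\<close>
    define m' where "m' = m(a := f)"
    have "perfect_matching G (m' ` A)"
      using m ab f by (intro perfect_matching_of_bij[OF bij]) (auto simp: m'_def h'_def)
    moreover have "f \<in> m' ` A" using ab unfolding m'_def by auto
    ultimately show ?thesis by blast
  qed
  moreover have "4 \<le> card (verts G)" using two eq card_verts by linarith
  ultimately show ?thesis using graph unfolding matching_covered_def by blast
qed

lemma matching_covered_iff:
  "matching_covered G \<longleftrightarrow> card A = card B \<and> 2 \<le> card A \<and> surplus A (adj G A)"
  using matching_covered_imp_surplus surplus_imp_matching_covered by blast

lemma delete_edge: "bipartite_graph (delete_edge G e) A B"
  using graph bipartition
  unfolding bipartite_graph_def bipartition_def graph_def delete_edge_def by auto

text \<open>Inclusions rather than an equation, since a parallel edge may keep the ends of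
  \<open>e\<close> adjacent.\<close>

lemma adj_delete_edge:
  assumes "ends G e = {a, b}"
  shows "adj G A - {(a, b), (b, a)} \<subseteq> adj (delete_edge G e) A" "adj (delete_edge G e) A \<subseteq> adj G A"
  using assms unfolding adj_def neighbours_def delete_edge_def by (auto simp: doubleton_eq_iff)

end

section \<open>Minimal bipartite matching covered graphs\<close>

locale minimal_bipartite = bipartite_graph +
  assumes minimal: "minimal_matching_covered G"
begin

lemma swap_minimal: "minimal_bipartite G B A"
  using swap minimal unfolding minimal_bipartite_def minimal_bipartite_axioms_def by blast

lemma mc: "matching_covered G" and
  not_mc: "e \<in> edges G \<Longrightarrow> \<not> matching_covered (delete_edge G e)"
  using minimal unfolding minimal_matching_covered_def by auto

lemma balanced: "card A = card B" "2 \<le> card A"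
  and sur: "X \<subseteq> A \<Longrightarrow> X \<noteq> {} \<Longrightarrow> X \<noteq> A \<Longrightarrow> card X < card (adj G A `` X)"
  using mc unfolding matching_covered_iff surplus_def by auto

text \<open>After deleting \<open>e\<close> some set \<open>X\<close> loses its surplus. Only
  \<open>b\<close> can have left its neighbourhood, and only if \<open>a\<close> was the sole
  neighbour of \<open>b\<close> in \<open>X\<close> and no edge is parallel to \<open>e\<close>;
  hence the surplus of \<open>X\<close> was exactly one.\<close>

lemma critical_set:
  assumes e: "e \<in> edges G" "ends G e = {a, b}" "a \<in> A" "b \<in> B"
  shows "(a, b) \<notin> adj (delete_edge G e) A"
    and "\<exists>X\<subseteq>A. X \<noteq> A \<and> X \<inter> (adj G A)\<inverse> `` {b} = {a} \<and> card (adj G A `` X) = Suc (card X)"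
proof -
  let ?E = "adj G A" and ?D = "adj (delete_edge G e) A"
  interpret D: bipartite_graph "delete_edge G e" A B by (rule delete_edge)
  have "\<not> surplus A ?D" using not_mc[OF e(1)] D.matching_covered_iff balanced by blast
  then obtain X where X: "X \<subseteq> A" "X \<noteq> {}" "X \<noteq> A" "card (?D `` X) \<le> card X"
    unfolding surplus_def by (meson not_less)
  have lt: "card (?D `` X) < card (?E `` X)" using sur[OF X(1-3)] X(4) by linarith
  have sub: "?E - {(a, b)} \<subseteq> ?D" "?D \<subseteq> ?E"
    using adj_delete_edge[OF e(2)] adj_subset e(3,4) disjoint by blast+
  have fD: "finite (?D `` X)" using D.finite_adj by (rule finite_Image)
  have b: "b \<in> ?E `` X - ?D `` X"
  proof (rule ccontr)
    assume "\<not> ?thesis"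
    then have "?E `` X \<subseteq> ?D `` X" using sub by blast
    then show False using card_mono[OF fD, of "?E `` X"] lt by simp
  qed
  then have "a \<in> X" "(a, b) \<notin> ?D" using sub by blast+
  then show "(a, b) \<notin> ?D" by blast
  have "?E `` X \<subseteq> insert b (?D `` X)" using sub by blast
  then have "card (?E `` X) \<le> card (insert b (?D `` X))" using fD by (intro card_mono) auto
  also have "\<dots> \<le> Suc (card X)" using X(4) fD by (simp add: card_insert_if)
  finally have "card (?E `` X) = Suc (card X)" using sur[OF X(1-3)] by linarith
  moreover have "X \<inter> ?E\<inverse> `` {b} = {a}" using b sub \<open>a \<in> X\<close> by blast
  ultimately show "\<exists>X\<subseteq>A. X \<noteq> A \<and> X \<inter> ?E\<inverse> `` {b} = {a} \<and> card (?E `` X) = Suc (card X)"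
    using X(1,3) by (intro exI[of _ X]) simp
qed

sublocale minimal_surplus A B "adj G A"
proof
  fix a b assume "(a, b) \<in> adj G A"
  then obtain e where e: "e \<in> edges G" "ends G e = {a, b}" "a \<in> A" "b \<in> B"
    unfolding adj_iff by blast
  show "\<exists>X\<subseteq>A. X \<noteq> A \<and> X \<inter> (adj G A)\<inverse> `` {b} = {a} \<and> card (adj G A `` X) = Suc (card X)"
    by (rule critical_set(2)[OF e])
qed (use fin adj_subset balanced sur in auto)

text \<open>Minimality forbids parallel edges: a second edge would keep the ends adjacent after the
  first is deleted.\<close>

lemma inj_ends: "inj_on (ends G) (edges G)"
proof (rule inj_onI, rule ccontr)
  fix e f assume ef: "e \<in> edges G" "f \<in> edges G" "ends G e = ends G f" "e \<noteq> f"
  obtain a b where ab: "a \<in> A" "b \<in> B" "ends G e = {a, b}" using edge_ends ef by blast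
  have "(a, b) \<in> adj (delete_edge G e) A"
    using ab ef unfolding adj_def neighbours_def delete_edge_def by auto
  then show False using critical_set(1)[OF ef(1) ab(3,1,2)] by blast
qed

lemma card_edges: "card (edges G) = card (adj G A)"
proof -
  have "ends G ` edges G = (\<lambda>(a, b). {a, b}) ` adj G A"
  proof
    show "ends G ` edges G \<subseteq> (\<lambda>(a, b). {a, b}) ` adj G A"
    proof
      fix s assume "s \<in> ends G ` edges G"
      then obtain e where e: "e \<in> edges G" "s = ends G e" by blast
      obtain a b where "a \<in> A" "b \<in> B" "ends G e = {a, b}" using edge_ends e(1) by blast
      then have "(a, b) \<in> adj G A" "s = {a, b}" using adj_iff e by auto
      then show "s \<in> (\<lambda>(a, b). {a, b}) ` adj G A" by (auto intro!: image_eqI[of _ _ "(a, b)"])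
    qed
    show "(\<lambda>(a, b). {a, b}) ` adj G A \<subseteq> ends G ` edges G"
      by (clarsimp simp: adj_iff) (metis imageI)
  qed
  moreover have "inj_on (\<lambda>(a, b). {a, b}) (adj G A)"
  proof (clarsimp simp: inj_on_def)
    fix a b c d assume ab: "(a, b) \<in> adj G A" and cd: "(c, d) \<in> adj G A" and eq: "{a, b} = {c, d}"
    have "a \<in> A" "b \<in> B" "c \<in> A" "d \<in> B" using ab cd adj_iff by simp_all
    then show "a = c \<and> b = d" using eq disjoint by (auto simp: doubleton_eq_iff)
  qed
  ultimately show ?thesis using card_image[OF inj_ends] card_image[of "\<lambda>(a, b). {a, b}" "adj G A"] by simp
qed

lemma degree_eq: "degree G v = card (neighbours G v)"
proof -
  have "ends G ` {e \<in> edges G. v \<in> ends G e} = (\<lambda>w. {v, w}) ` neighbours G v"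
  proof
    show "ends G ` {e \<in> edges G. v \<in> ends G e} \<subseteq> (\<lambda>w. {v, w}) ` neighbours G v"
    proof
      fix s assume "s \<in> ends G ` {e \<in> edges G. v \<in> ends G e}"
      then obtain e where e: "e \<in> edges G" "v \<in> ends G e" "s = ends G e" by blast
      obtain a b where "ends G e = {a, b}" using edge_ends e(1) by blast
      then obtain w where "ends G e = {v, w}" using e(2) by (auto simp: insert_commute)
      then show "s \<in> (\<lambda>w. {v, w}) ` neighbours G v" using e unfolding neighbours_def by blast
    qed
  qed (auto simp: neighbours_def)
  moreover have "inj_on (\<lambda>w. {v, w}) (neighbours G v)" by (auto simp: inj_on_def doubleton_eq_iff)
  moreover have "inj_on (ends G) {e \<in> edges G. v \<in> ends G e}"
    using inj_ends by (rule inj_on_subset) auto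
  ultimately show ?thesis
    unfolding degree_loopless[OF graph] by (simp add: card_image[symmetric])
qed

lemma degree_ge_two:
  assumes "v \<in> A"
  shows "2 \<le> degree G v"
proof -
  have "{v} \<noteq> A" using balanced by auto
  then show ?thesis using sur[of "{v}"] assms adj_singleton degree_eq by fastforce
qed

text \<open>The count for the relation \<open>adj G A\<close>, restated for the graph; the two
  classes are equally large, so \<open>2 * card A\<close> is the number of vertices.\<close>

lemma card_V2_side:
  assumes "\<And>b. b \<in> B \<Longrightarrow> degree G b = 2 \<Longrightarrow> \<exists>a\<in>neighbours G b. degree G a = 2"
  shows "card (edges G) + 2 \<le> card (verts G) + card (V2 G \<inter> A)"
proof -
  have nb: "adj G A `` {a} = neighbours G a" if "a \<in> A" for a using that by (rule adj_singleton)
  have nb': "(adj G A)\<inverse> `` {b} = neighbours G b" if "b \<in> B" for b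
    unfolding adj_converse using that by (rule bipartite_graph.adj_singleton[OF swap])
  have "card (adj G A) + 2 \<le> 2 * card A + card {a \<in> A. card (adj G A `` {a}) = 2}"
  proof (rule card_degree_two)
    fix b assume b: "b \<in> B" "card ((adj G A)\<inverse> `` {b}) = 2"
    then obtain a where a: "a \<in> neighbours G b" "degree G a = 2"
      using assms nb' degree_eq by metis
    then have "a \<in> A" using bipartite_graph.neighbours_subset[OF swap] b by blast
    then show "\<exists>a\<in>(adj G A)\<inverse> `` {b}. card (adj G A `` {a}) = 2"
      using a nb nb' b degree_eq by metis
  qed
  moreover have "{a \<in> A. card (adj G A `` {a}) = 2} = V2 G \<inter> A"
    using nb degree_eq verts_eq unfolding V2_def by auto
  ultimately show ?thesis using card_edges card_verts balanced by simp
qed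

lemma card_V2_irreducible:
  assumes "\<And>v. v \<in> V2 G \<Longrightarrow> \<exists>w\<in>neighbours G v. degree G w = 2"
  shows "2 * (int (card (edges G)) - int (card (verts G)) + 2) \<le> int (card (V2 G))"
proof -
  have "card (edges G) + 2 \<le> card (verts G) + card (V2 G \<inter> A)"
    using assms verts_eq by (intro card_V2_side) (auto simp: V2_def)
  moreover have "card (edges G) + 2 \<le> card (verts G) + card (V2 G \<inter> B)"
    using assms verts_eq by (intro minimal_bipartite.card_V2_side[OF swap_minimal]) (auto simp: V2_def)
  moreover have "card (V2 G) = card (V2 G \<inter> A) + card (V2 G \<inter> B)"
    using verts_eq disjoint fin by (subst card_Un_disjoint[symmetric]) (auto simp: V2_def intro!: arg_cong[where f = card])
  ultimately show ?thesis by presburger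
qed

end

subsection \<open>Bicontraction\<close>

lemma bicontraction_simps:
  "verts (bicontraction G v) = verts G - neighbours G v"
  "edges (bicontraction G v) = {e \<in> edges G. v \<notin> ends G e}"
  "ends (bicontraction G v) e = (\<lambda>u. if u \<in> neighbours G v then v else u) ` ends G e"
  by (simp_all add: bicontraction_def)

lemma bicontraction_delete_edge:
  assumes "v \<notin> ends G e"
  shows "neighbours (delete_edge G e) v = neighbours G v"
    and "bicontraction (delete_edge G e) v = delete_edge (bicontraction G v) e"
proof -
  show nb: "neighbours (delete_edge G e) v = neighbours G v"
    using assms by (auto simp: neighbours_def delete_edge_def)
  show "bicontraction (delete_edge G e) v = delete_edge (bicontraction G v) e"
    unfolding bicontraction_def nb by (auto simp: delete_edge_def)
qed

locale bicontractible = bipartite_graph +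
  fixes v v1 v2
  assumes v: "v \<in> B" and nbs: "neighbours G v = {v1, v2}" and distinct: "v1 \<noteq> v2"
begin

text \<open>The name \<open>v\<close> changes sides: in \<open>G\<close> it belongs to
  \<open>B\<close>, but as the contraction vertex of \<open>H\<close> it takes the place of
  \<open>v1\<close> and \<open>v2\<close> in the other class.\<close>

abbreviation "A' \<equiv> insert v (A - {v1, v2})"
abbreviation "B' \<equiv> B - {v}"
abbreviation "H \<equiv> bicontraction G v"

lemma v12: "v1 \<in> A" "v2 \<in> A"
  using bipartite_graph.neighbours_subset[OF swap v] nbs by auto

lemma v_notin: "v \<notin> A" "v \<noteq> v1" "v \<noteq> v2"
  using v v12 disjoint by auto

lemma ends_H:
  assumes "a \<in> A" "b \<in> B" "b \<noteq> v" "ends G e = {a, b}"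
  shows "ends H e = {if a \<in> {v1, v2} then v else a, b}"
  using assms v12 disjoint by (auto simp: bicontraction_simps nbs)

lemma bipartite_H: "bipartite_graph H A' B'"
proof
  have e: "\<exists>a'\<in>A'. \<exists>b\<in>B'. ends H e = {a', b}" if "e \<in> edges H" for e
  proof -
    have eG: "e \<in> edges G" "v \<notin> ends G e" using that by (auto simp: bicontraction_simps)
    obtain a b where ab: "a \<in> A" "b \<in> B" "ends G e = {a, b}" using edge_ends eG(1) by blast
    have "b \<noteq> v" using ab(3) eG(2) by auto
    then have "ends H e = {if a \<in> {v1, v2} then v else a, b}" using ends_H ab by blast
    moreover have "(if a \<in> {v1, v2} then v else a) \<in> A'" "b \<in> B'" using ab \<open>b \<noteq> v\<close> by auto
    ultimately show ?thesis by blast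
  qed
  have vH: "verts H = A' \<union> B'" using verts_eq v12 v disjoint by (auto simp: bicontraction_simps nbs)
  have dis: "A' \<inter> B' = {}" using disjoint by auto
  show "bipartition H A' B'" unfolding bipartition_def using vH dis e by fastforce
  have "finite (verts H)" "finite (edges H)"
    using fin verts_eq by (auto simp: bicontraction_simps)
  moreover have "ends H e \<subseteq> verts H \<and> card (ends H e) = 2" if he: "e \<in> edges H" for e
  proof -
    obtain a b where ab: "a \<in> A'" "b \<in> B'" "ends H e = {a, b}" using e[OF he] by blast
    then have "a \<noteq> b" using dis by blast
    then show ?thesis using ab vH by auto
  qed
  ultimately show "graph H" unfolding graph_def by blast
qed

lemma card_sides:
  "Suc (card A') = card A" "Suc (card B') = card B"
proof -
  have "card (A - {v1, v2}) = card A - 2" using v12 distinct by (subst card_Diff_subset) auto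
  moreover have "2 \<le> card A" using v12 distinct card_mono[OF fin(1), of "{v1, v2}"] by auto
  ultimately show "Suc (card A') = card A" using v_notin fin by simp
  show "Suc (card B') = card B" using v fin by (metis card_Suc_Diff1)
qed

text \<open>Undoes the contraction on a set of vertices of \<open>H\<close>. The lifts are the
  subsets of \<open>A\<close> containing both or neither of \<open>v1\<close> and
  \<open>v2\<close>.\<close>

definition lift :: "'a set \<Rightarrow> 'a set" where
  "lift X = (if v \<in> X then X - {v} \<union> {v1, v2} else X)"

lemma adj_H:
  "(a, b) \<in> adj H A' \<longleftrightarrow> b \<noteq> v \<and> (if a = v then (v1, b) \<in> adj G A \<or> (v2, b) \<in> adj G A
     else a \<notin> {v1, v2} \<and> (a, b) \<in> adj G A)"
proof -
  interpret H: bipartite_graph H A' B' by (rule bipartite_H)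
  have v_ends: "e \<in> edges G \<Longrightarrow> ends G e = {a, b} \<Longrightarrow> a \<in> A \<Longrightarrow> b \<in> B \<Longrightarrow> b \<noteq> v \<Longrightarrow> v \<notin> ends G e"
    for e a b using v_notin by auto
  show ?thesis
  proof
    assume "(a, b) \<in> adj H A'"
    then obtain e where e: "a \<in> A'" "b \<in> B'" "e \<in> edges H" "ends H e = {a, b}"
      using H.adj_iff by blast
    have eG: "e \<in> edges G" "v \<notin> ends G e" using e by (auto simp: bicontraction_simps)
    obtain a1 b1 where ab: "a1 \<in> A" "b1 \<in> B" "ends G e = {a1, b1}" using edge_ends eG(1) by blast
    have "b1 \<noteq> v" using ab eG by auto
    then have "ends H e = {if a1 \<in> {v1, v2} then v else a1, b1}" using ends_H ab by blast
    then have "b = b1" "a = (if a1 \<in> {v1, v2} then v else a1)"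
      using e ab v_notin disjoint v by (auto simp: doubleton_eq_iff split: if_splits)
    moreover have "(a1, b1) \<in> adj G A" using adj_iff ab eG by blast
    ultimately show "b \<noteq> v \<and> (if a = v then (v1, b) \<in> adj G A \<or> (v2, b) \<in> adj G A
        else a \<notin> {v1, v2} \<and> (a, b) \<in> adj G A)"
      using e(2) ab(1) v_notin by (auto split: if_splits)
  next
    assume r: "b \<noteq> v \<and> (if a = v then (v1, b) \<in> adj G A \<or> (v2, b) \<in> adj G A
        else a \<notin> {v1, v2} \<and> (a, b) \<in> adj G A)"
    then obtain a1 where a1: "(a1, b) \<in> adj G A" "a = (if a1 \<in> {v1, v2} then v else a1)"
      by (metis insertCI singletonD insertE)
    then obtain e where e: "a1 \<in> A" "b \<in> B" "e \<in> edges G" "ends G e = {a1, b}" using adj_iff by blast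
    then have "ends H e = {a, b}" using ends_H a1(2) r by blast
    moreover have "e \<in> edges H" using v_ends e r by (auto simp: bicontraction_simps)
    moreover have "a \<in> A'" "b \<in> B'" using a1(2) e r by auto
    ultimately show "(a, b) \<in> adj H A'" using H.adj_iff by blast
  qed
qed

lemma adj_v: "(a, v) \<in> adj G A \<longleftrightarrow> a \<in> {v1, v2}"
proof -
  have "(a, v) \<in> adj G A \<longleftrightarrow> a \<in> neighbours G v"
    using adj_converse v bipartite_graph.adj_singleton[OF swap v] by blast
  then show ?thesis using nbs by simp
qed

lemma adj_lift:
  assumes "X \<subseteq> A'"
  shows "adj G A `` lift X = adj H A' `` X \<union> (if v \<in> X then {v} else {})"
proof (rule set_eqI)
  fix b
  have X: "v1 \<notin> X" "v2 \<notin> X" using assms v_notin by auto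
  have mem: "a \<in> lift X \<longleftrightarrow> (if a \<in> {v1, v2} then v \<in> X else a \<in> X \<and> a \<noteq> v)"
    if "a \<in> A" for a
    using that X v_notin unfolding lift_def by auto
  show "b \<in> adj G A `` lift X \<longleftrightarrow> b \<in> adj H A' `` X \<union> (if v \<in> X then {v} else {})"
  proof (cases "b = v")
    case True
    have "b \<in> adj G A `` lift X \<longleftrightarrow> v1 \<in> lift X \<or> v2 \<in> lift X" using True adj_v by auto
    also have "\<dots> \<longleftrightarrow> v \<in> X" using mem[OF v12(1)] mem[OF v12(2)] by simp
    finally show ?thesis using True adj_H by auto
  next
    case False
    have "b \<in> adj G A `` lift X \<longleftrightarrow> b \<in> adj H A' `` X"
    proof
      assume "b \<in> adj G A `` lift X"
      then obtain a where a: "a \<in> lift X" "(a, b) \<in> adj G A" by (rule ImageE)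
      let ?a = "if a \<in> {v1, v2} then v else a"
      have "a \<in> A" using a(2) adj_iff by simp
      then have "?a \<in> X" "(?a, b) \<in> adj H A'" using mem a False v_notin adj_H by (auto split: if_splits)
      then show "b \<in> adj H A' `` X" by (rule ImageI[rotated])
    next
      assume "b \<in> adj H A' `` X"
      then obtain a where a: "a \<in> X" "(a, b) \<in> adj H A'" by (rule ImageE)
      then obtain a' where a': "(a', b) \<in> adj G A" "a' = a \<and> a \<noteq> v \<or> a = v \<and> a' \<in> {v1, v2}"
        unfolding adj_H by (auto split: if_splits)
      then have "a' \<in> lift X" using mem[of a'] a(1) X adj_iff by (auto split: if_splits)
      then show "b \<in> adj G A `` lift X" using a'(1) by (rule ImageI[rotated])
    qed
    then show ?thesis using False by simp
  qed
qed

text \<open>Lifting does not change the surplus: when \<open>v\<close> is in \<open>X\<close>, the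
  set grows by one, and its neighbourhood gains exactly the vertex \<open>v\<close> of
  \<open>G\<close>.\<close>

lemma card_lift:
  assumes "X \<subseteq> A'"
  shows "card (lift X) = card X + (if v \<in> X then 1 else 0)"
    and "card (adj G A `` lift X) = card (adj H A' `` X) + (if v \<in> X then 1 else 0)"
proof -
  have fX: "finite X" using assms fin(1) finite_subset by blast
  show "card (lift X) = card X + (if v \<in> X then 1 else 0)"
  proof (cases "v \<in> X")
    case True
    have "card (X - {v} \<union> {v1, v2}) = card (X - {v}) + card {v1, v2}"
      using assms fX by (intro card_Un_disjoint) auto
    then show ?thesis using True fX distinct card_Suc_Diff1[OF fX True] by (simp add: lift_def)
  qed (simp add: lift_def)
  have "v \<notin> adj H A' `` X" using adj_H by blast
  moreover have "finite (adj H A' `` X)"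
    using bipartite_graph.finite_adj[OF bipartite_H] by (rule finite_Image)
  ultimately show "card (adj G A `` lift X) = card (adj H A' `` X) + (if v \<in> X then 1 else 0)"
    unfolding adj_lift[OF assms] by simp
qed

lemma lift_proper:
  assumes "X \<subseteq> A'" "X \<noteq> {}" "X \<noteq> A'"
  shows "lift X \<subseteq> A" "lift X \<noteq> {}" "lift X \<noteq> A"
  using assms v12 v_notin unfolding lift_def by (auto split: if_splits)

lemma matching_covered_bicontraction:
  assumes mc: "matching_covered G" and three: "3 \<le> card A"
  shows "matching_covered H"
proof -
  interpret H: bipartite_graph H A' B' by (rule bipartite_H)
  have G: "card A = card B" "surplus A (adj G A)" using mc unfolding matching_covered_iff by auto
  have "card X < card (adj H A' `` X)" if "X \<subseteq> A'" "X \<noteq> {}" "X \<noteq> A'" for X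
  proof -
    have "card (lift X) < card (adj G A `` lift X)"
      using G(2) lift_proper[OF that] unfolding surplus_def by blast
    then show ?thesis using card_lift[OF that(1)] by simp
  qed
  then show ?thesis
    unfolding H.matching_covered_iff surplus_def using card_sides G(1) three by simp
qed

text \<open>Sets with both or neither of \<open>v1\<close> and \<open>v2\<close> are lifts and
  inherit their surplus from \<open>H\<close>. A set with just one of them is treated by removing
  that vertex, the degree assumption covering the case in which nothing remains.\<close>

lemma matching_covered_of_bicontraction:
  assumes mc: "matching_covered H" and deg: "2 \<le> card (neighbours G v1)" "2 \<le> card (neighbours G v2)"
  shows "matching_covered G"
proof -
  interpret H: bipartite_graph H A' B' by (rule bipartite_H)
  have H: "card A' = card B'" "2 \<le> card A'" "surplus A' (adj H A')"
    using mc unfolding H.matching_covered_iff by auto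
  have sur: "card X < card (adj H A' `` X)" if "X \<subseteq> A'" "X \<noteq> {}" "X \<noteq> A'" for X
    using H(3) that unfolding surplus_def by blast
  have finN: "finite (adj G A `` X)" "finite (adj H A' `` X)" for X
    using finite_adj H.finite_adj by (auto intro: finite_Image)
  have lifted: "card (lift X) < card (adj G A `` lift X)" if "X \<subseteq> A'" "X \<noteq> {}" "X \<noteq> A'" for X
    using sur[OF that] card_lift[OF that(1)] by simp
  have half: "card X < card (adj G A `` X)"
    if X: "X \<subseteq> A" and w: "w \<in> X" "w' \<notin> X" "{w, w'} = {v1, v2}" and d: "2 \<le> card (neighbours G w)" for X w w'
  proof (cases "X = {w}")
    case True
    then show ?thesis using d X adj_singleton[of w] by simp
  next
    case False
    \<comment> \<open>\<open>?Y\<close> contains neither \<open>v1\<close> nor \<open>v2\<close>, so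
      it is its own lift and \<open>v\<close> is not adjacent to it. Adding \<open>w\<close> back
      gains at least the neighbour \<open>v\<close>.\<close>
    let ?Y = "X - {w}"
    have vY: "v \<notin> ?Y" using X v_notin by blast
    have "?Y \<subseteq> A'" "?Y \<noteq> {}" using X w False by auto
    moreover have "?Y \<noteq> A'" using vY by blast
    moreover have lY: "lift ?Y = ?Y" using vY unfolding lift_def by presburger
    ultimately have lt: "card ?Y < card (adj G A `` ?Y)" using lifted[of ?Y] by presburger
    have "(if v \<in> ?Y then {v} else {}) = {}" using vY by presburger
    then have eq: "adj G A `` ?Y = adj H A' `` ?Y"
      using adj_lift[OF \<open>?Y \<subseteq> A'\<close>] unfolding lY by simp
    have "v \<in> adj G A `` X" using adj_v[of w] w by blast
    then have "insert v (adj H A' `` ?Y) \<subseteq> adj G A `` X" unfolding eq[symmetric] by blast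
    then have "card (insert v (adj H A' `` ?Y)) \<le> card (adj G A `` X)"
      using finN by (intro card_mono) auto
    moreover have "v \<notin> adj H A' `` ?Y" using adj_H by blast
    moreover have "Suc (card ?Y) = card X" using w X fin(1) finite_subset card_Suc_Diff1 by metis
    ultimately show ?thesis using finN lt eq by simp
  qed
  have "card X < card (adj G A `` X)" if X: "X \<subseteq> A" "X \<noteq> {}" "X \<noteq> A" for X
  proof -
    consider "v1 \<in> X" "v2 \<in> X" | "v1 \<in> X" "v2 \<notin> X" | "v1 \<notin> X" "v2 \<in> X" | "v1 \<notin> X" "v2 \<notin> X" by blast
    then show ?thesis
    proof cases
      case 1
      let ?Y = "insert v (X - {v1, v2})"
      have "lift ?Y = X" using 1 X v_notin by (auto simp: lift_def)
      moreover have "?Y \<subseteq> A'" "?Y \<noteq> {}" using X by auto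
      moreover have "?Y \<noteq> A'"
      proof
        assume "?Y = A'"
        then have "X - {v1, v2} = A - {v1, v2}"
          using X(1) v_notin(1) insert_ident[of v "X - {v1, v2}" "A - {v1, v2}"] by auto
        then show False using 1 X v12 by blast
      qed
      ultimately show ?thesis using lifted[of ?Y] by simp
    next
      case 2
      then show ?thesis using half[of X v1 v2] X deg by blast
    next
      case 3
      then show ?thesis using half[of X v2 v1] X deg by blast
    next
      case 4
      then have "lift X = X" "X \<subseteq> A'" "X \<noteq> A'" using X v_notin by (auto simp: lift_def)
      then show ?thesis using lifted[of X] X by simp
    qed
  qed
  then show ?thesis
    unfolding matching_covered_iff surplus_def using card_sides H by simp
qed

lemma delete_bicontractible:
  assumes "v \<notin> ends G e"
  shows "bicontractible (delete_edge G e) A B v v1 v2"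
  using delete_edge v nbs distinct bicontraction_delete_edge(1)[OF assms]
  unfolding bicontractible_def bicontractible_axioms_def by simp

end

lemma neighbours_delete_edge:
  assumes "\<And>w. ends G e \<noteq> {v, w} "
  shows "neighbours (delete_edge G e) v = neighbours G v"
  using assms unfolding neighbours_def delete_edge_def by auto

text \<open>Loops are allowed here, since the lemma also serves graphs not yet known to be loopless.
  A loop would add two to the degree, which the edges to two distinct neighbours already
  exhaust.\<close>

lemma degree_two_edges:
  assumes fin: "finite (edges G)" and deg: "degree G v = 2"
    and nbs: "neighbours G v = {v1, v2}" and distinct: "v1 \<noteq> v2"
  obtains e1 e2 where "e1 \<in> edges G" "e2 \<in> edges G" "e1 \<noteq> e2" "ends G e1 = {v, v1}" "ends G e2 = {v, v2}"
    "{e \<in> edges G. v \<in> ends G e} = {e1, e2}" "v \<noteq> v1" "v \<noteq> v2"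
proof -
  let ?I = "{e \<in> edges G. v \<in> ends G e}" and ?L = "{e \<in> edges G. ends G e = {v}}"
  have "v1 \<in> neighbours G v" "v2 \<in> neighbours G v" using nbs by simp_all
  then obtain e1 e2 where e: "e1 \<in> edges G" "e2 \<in> edges G" "ends G e1 = {v, v1}" "ends G e2 = {v, v2}"
    unfolding neighbours_def by auto
  then have ne: "e1 \<noteq> e2" using distinct by (metis doubleton_eq_iff)
  have sub: "{e1, e2} \<subseteq> ?I" using e by auto
  have fI: "finite ?I" "finite ?L" using fin by auto
  have "2 \<le> card ?I" using card_mono[OF fI(1) sub] ne by simp
  then have I: "card ?I = 2" and L: "card ?L = 0" using deg unfolding degree_def by linarith+
  have "?I = {e1, e2}" using card_subset_eq[OF fI(1) sub] I ne by simp
  moreover have "?L = {}" using L fI(2) by simp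
  then have "v \<noteq> v1" "v \<noteq> v2" using e by auto
  ultimately show thesis using that[of e1 e2] e ne by simp
qed

section \<open>Bicontraction preserves minimality; its effect on degrees and counts\<close>

locale minimal_bicontractible = minimal_bipartite G A B + bicontractible G A B v v1 v2
  for G :: "('v, 'e) mgraph" and A B v v1 v2 +
  assumes balanced_ends: "3 \<le> degree G v1 \<and> 3 \<le> degree G v2 \<or> degree G v1 = 2 \<and> degree G v2 = 2"
    and three: "3 \<le> card A"
begin

lemma card_delete_neighbours: "card (neighbours G w) \<le> Suc (card (neighbours (delete_edge G e) w))"
proof -
  interpret D: bipartite_graph "delete_edge G e" A B by (rule delete_edge)
  show ?thesis
  proof (cases "\<exists>x. ends G e = {w, x}")
    case True
    then obtain x where x: "ends G e = {w, x}" by blast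
    have "neighbours G w \<subseteq> insert x (neighbours (delete_edge G e) w)"
      using x unfolding neighbours_def delete_edge_def by (auto simp: doubleton_eq_iff)
    then have "card (neighbours G w) \<le> card (insert x (neighbours (delete_edge G e) w))"
      using D.neighbours_finite by (intro card_mono) auto
    also have "\<dots> \<le> Suc (card (neighbours (delete_edge G e) w))"
      by (simp add: card_insert_if D.neighbours_finite)
    finally show ?thesis .
  next
    case False
    then show ?thesis using neighbours_delete_edge[of G e w] by simp
  qed
qed

text \<open>If both neighbours of \<open>v\<close> have degree at least three, deleting one edge
  leaves each with two neighbours. If both have degree two and \<open>w\<close> is left with
  \<open>v\<close> alone, the contraction vertex of \<open>H\<close> without \<open>e\<close> has at
  most one neighbour, which a matching covered graph does not allow.\<close>

lemma delete_degree:
  assumes e: "e \<in> edges H" and mc: "matching_covered (delete_edge H e)" and w: "w \<in> {v1, v2}"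
  shows "2 \<le> card (neighbours (delete_edge G e) w)"
proof (rule ccontr)
  assume small: "\<not> ?thesis"
  have eG: "e \<in> edges G" "v \<notin> ends G e" using e by (auto simp: bicontraction_simps)
  have le: "card (neighbours G w) \<le> Suc (card (neighbours (delete_edge G e) w))"
    by (rule card_delete_neighbours)
  then have two: "degree G v1 = 2" "degree G v2 = 2" using small balanced_ends w degree_eq by auto
  have we: "\<exists>x. ends G e = {w, x}"
    using small two w degree_eq neighbours_delete_edge[of G e w] by fastforce
  interpret D: bicontractible "delete_edge G e" A B v v1 v2 by (rule delete_bicontractible[OF eG(2)])
  interpret DH: bipartite_graph "delete_edge H e" A' B'
    using D.bipartite_H bicontraction_delete_edge[OF eG(2)] by simp
  have one: "card (neighbours G x - {v}) \<le> 1" if "x \<in> {v1, v2}" for x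
  proof -
    have "v \<in> neighbours G x" using nbs that neighbours_sym by fastforce
    then show ?thesis using two that degree_eq neighbours_finite by (auto simp: card_Diff_singleton_if)
  qed
  have "neighbours (delete_edge G e) w \<subseteq> {v}"
  proof -
    have "v \<in> neighbours (delete_edge G e) w" using D.nbs w neighbours_sym by fastforce
    moreover have "card (neighbours (delete_edge G e) w) \<le> Suc 0" using small by simp
    ultimately show ?thesis using D.neighbours_finite card_le_Suc0_iff_eq by blast
  qed
  moreover obtain w' where w': "{v1, v2} = {w, w'}" "w' \<in> {v1, v2}" using w by auto
  moreover have "neighbours (delete_edge G e) w' \<subseteq> neighbours G w'"
    unfolding neighbours_def delete_edge_def by auto
  moreover have "adj (delete_edge H e) A' `` {v} \<subseteq>
      neighbours (delete_edge G e) w \<union> neighbours (delete_edge G e) w' - {v}"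
  proof
    fix b assume "b \<in> adj (delete_edge H e) A' `` {v}"
    then have "(v, b) \<in> adj (bicontraction (delete_edge G e) v) A'"
      unfolding bicontraction_delete_edge(2)[OF eG(2)] by simp
    then obtain x where x: "x \<in> {v1, v2}" "(x, b) \<in> adj (delete_edge G e) A" "b \<noteq> v"
      unfolding D.adj_H by auto
    then have "b \<in> neighbours (delete_edge G e) x" unfolding adj_def by simp
    then show "b \<in> neighbours (delete_edge G e) w \<union> neighbours (delete_edge G e) w' - {v}"
      using x w'(1) by auto
  qed
  ultimately have sub: "adj (delete_edge H e) A' `` {v} \<subseteq> neighbours G w' - {v}" by blast
  have "card (adj (delete_edge H e) A' `` {v}) \<le> 1"
    using card_mono[OF _ sub] neighbours_finite one[OF w'(2)] by fastforce
  have big: "2 \<le> card A'" and sur: "surplus A' (adj (delete_edge H e) A')"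
    using mc DH.matching_covered_iff by auto
  have "{v} \<noteq> A'"
  proof
    assume "{v} = A'"
    then have "card A' = card {v}" by (rule arg_cong[OF sym])
    then show False using big by simp
  qed
  then have "card {v} < card (adj (delete_edge H e) A' `` {v})"
    using sur[unfolded surplus_def, rule_format, of "{v}"] by simp
  then show False using \<open>card (adj (delete_edge H e) A' `` {v}) \<le> 1\<close> by simp
qed

text \<open>Deleting an edge away from \<open>v\<close> commutes with the bicontraction, so an edge
  deletable from \<open>H\<close> would be deletable from \<open>G\<close>.\<close>

lemma minimal_H: "minimal_bipartite H A' B'"
proof -
  interpret H: bipartite_graph H A' B' by (rule bipartite_H)
  have "\<not> matching_covered (delete_edge H e)" if e: "e \<in> edges H" for e
  proof
    assume mcH: "matching_covered (delete_edge H e)"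
    have eG: "e \<in> edges G" "v \<notin> ends G e" using e by (auto simp: bicontraction_simps)
    interpret D: bicontractible "delete_edge G e" A B v v1 v2 by (rule delete_bicontractible[OF eG(2)])
    have "matching_covered (delete_edge G e)"
      using D.matching_covered_of_bicontraction delete_degree[OF e mcH]
        bicontraction_delete_edge[OF eG(2)] mcH by simp
    then show False using not_mc eG by blast
  qed
  then show ?thesis
    using matching_covered_bicontraction[OF mc three] H.bipartite_graph_axioms
    unfolding minimal_bipartite_def minimal_bipartite_axioms_def minimal_matching_covered_def by blast
qed

lemma degree_v: "degree G v = 2"
  using degree_eq nbs distinct by simp

lemma card_verts_H: "card (verts G) = card (verts H) + 2"
proof -
  interpret H: bipartite_graph H A' B' by (rule bipartite_H)
  show ?thesis using card_verts H.card_verts card_sides by linarith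
qed

lemma card_edges_H: "card (edges G) = card (edges H) + 2"
proof -
  have "card {e \<in> edges G. v \<in> ends G e} = 2" using degree_v degree_loopless[OF graph] by metis
  moreover have "edges H = edges G - {e \<in> edges G. v \<in> ends G e}" by (auto simp: bicontraction_simps)
  moreover have "card {e \<in> edges G. v \<in> ends G e} \<le> card (edges G)" using fin by (intro card_mono) auto
  ultimately show ?thesis using fin by (simp add: card_Diff_subset)
qed

lemma degree_H:
  assumes "x \<in> verts H" "x \<noteq> v"
  shows "degree H x = degree G x"
proof -
  interpret H: bipartite_graph H A' B' by (rule bipartite_H)
  have x: "x \<notin> {v1, v2}" using assms by (auto simp: bicontraction_simps nbs)
  have "v \<notin> ends G e" if "e \<in> edges G" "x \<in> ends G e" for e
  proof
    assume ve: "v \<in> ends G e"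
    obtain a b where "ends G e = {a, b}" using edge_ends \<open>e \<in> edges G\<close> by blast
    then have "ends G e = {v, x}" using that ve assms(2) by auto
    then show False using x nbs that unfolding neighbours_def by blast
  qed
  then have "{e \<in> edges H. x \<in> ends H e} = {e \<in> edges G. x \<in> ends G e}"
    using x assms(2) by (auto simp: bicontraction_simps nbs split: if_splits)
  then show ?thesis using degree_loopless[OF graph] degree_loopless[OF H.graph] by simp
qed

text \<open>The contraction vertex inherits the edges at \<open>v1\<close> and \<open>v2\<close>
  apart from the two contracted ones. No edge is counted twice, because \<open>v1\<close> and
  \<open>v2\<close> lie in the same class.\<close>

lemma degree_H_v: "degree H v + 2 = degree G v1 + degree G v2"
proof -
  interpret H: bipartite_graph H A' B' by (rule bipartite_H)
  let ?I = "\<lambda>x. {e \<in> edges G. x \<in> ends G e}"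
  obtain e1 e2 where e: "e1 \<in> edges G" "e2 \<in> edges G" "e1 \<noteq> e2" "ends G e1 = {v, v1}" "ends G e2 = {v, v2}"
    "?I v = {e1, e2}" by (rule degree_two_edges[OF fin(3) degree_v nbs distinct]) (rule that)
  have "{e \<in> edges H. v \<in> ends H e} = (?I v1 - {e1}) \<union> (?I v2 - {e2})"
    using e v_notin distinct by (auto simp: bicontraction_simps nbs split: if_splits)
  moreover have "(?I v1 - {e1}) \<inter> (?I v2 - {e2}) = {}"
  proof (rule ccontr)
    assume "\<not> ?thesis"
    then obtain f where f: "f \<in> edges G" "v1 \<in> ends G f" "v2 \<in> ends G f" by blast
    obtain a b where "a \<in> A" "b \<in> B" "ends G f = {a, b}" using edge_ends f(1) by blast
    then show False using f v12 distinct disjoint by auto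
  qed
  ultimately have "card {e \<in> edges H. v \<in> ends H e} = card (?I v1 - {e1}) + card (?I v2 - {e2})"
    using fin by (simp add: card_Un_disjoint)
  moreover have "Suc (card (?I v1 - {e1})) = card (?I v1)"
    using e fin by (intro card_Suc_Diff1) auto
  moreover have "Suc (card (?I v2 - {e2})) = card (?I v2)"
    using e fin by (intro card_Suc_Diff1) auto
  ultimately show ?thesis using degree_loopless[OF graph] degree_loopless[OF H.graph] by simp
qed

lemma V2_H: "V2 H - {v} = V2 G - {v, v1, v2}"
  using degree_H unfolding V2_def by (auto simp: bicontraction_simps nbs)

lemma v_V2: "v \<in> V2 G"
  using degree_v v verts_eq unfolding V2_def by blast

lemma v_verts_H: "v \<in> verts H"
  using bipartite_graph.verts_eq[OF bipartite_H] by blast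

text \<open>The contraction vertex has degree at least four, so exactly \<open>v\<close> leaves
  \<open>V2\<close>. No edge of \<open>E2\<close> is affected, as \<open>v\<close> had no neighbour
  of degree two.\<close>

lemma restricted_counts:
  assumes "3 \<le> degree G v1" "3 \<le> degree G v2"
  shows "card (V2 G) = Suc (card (V2 H))" "E2 H = E2 G"
proof -
  have "degree H v \<noteq> 2" using degree_H_v assms by linarith
  then have "v \<notin> V2 H" unfolding V2_def by blast
  moreover have n12: "v1 \<notin> V2 G" "v2 \<notin> V2 G" using assms unfolding V2_def by auto
  ultimately have V: "V2 H = V2 G - {v}" using V2_H by blast
  have "finite (V2 G)" using fin verts_eq unfolding V2_def by auto
  then show "card (V2 G) = Suc (card (V2 H))" using V v_V2 by (metis card_Suc_Diff1)
  have ends: "ends H e = ends G e" if "v1 \<notin> ends G e" "v2 \<notin> ends G e" for e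
    using that by (auto simp: bicontraction_simps nbs intro!: image_eqI)
  show "E2 H = E2 G"
  proof
    show "E2 H \<subseteq> E2 G"
    proof
      fix e assume e: "e \<in> E2 H"
      then have "v \<notin> ends H e" "e \<in> edges G" unfolding E2_def V by (auto simp: bicontraction_simps)
      then have "v1 \<notin> ends G e" "v2 \<notin> ends G e" by (auto simp: bicontraction_simps nbs)
      then show "e \<in> E2 G" using e ends \<open>e \<in> edges G\<close> unfolding E2_def V by auto
    qed
    show "E2 G \<subseteq> E2 H"
    proof
      fix e assume e: "e \<in> E2 G"
      then have n: "e \<in> edges G" "v1 \<notin> ends G e" "v2 \<notin> ends G e" using n12 unfolding E2_def by auto
      have ve: "v \<notin> ends G e"
      proof
        assume "v \<in> ends G e"
        then obtain x where "ends G e = {v, x}" using edge_ends[OF n(1)] by (metis insert_commute insertE singletonD)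
        then have "x \<in> neighbours G v" using n(1) unfolding neighbours_def by blast
        then show False using nbs n \<open>ends G e = {v, x}\<close> by auto
      qed
      then show "e \<in> E2 H" using e n ends unfolding E2_def V by (auto simp: bicontraction_simps(2))
    qed
  qed
qed

text \<open>Three vertices of degree two are replaced by a single one, as the contraction vertex
  again has degree 2 + 2 - 2 = 2.\<close>

lemma path_counts:
  assumes "degree G v1 = 2" "degree G v2 = 2"
  shows "card (V2 G) = card (V2 H) + 2"
proof -
  have "degree H v = 2" using degree_H_v assms by linarith
  then have "v \<in> V2 H" using v_verts_H unfolding V2_def by blast
  then have V: "V2 H = V2 G - {v1, v2}" using V2_H v_V2 v_notin by blast
  have "{v1, v2} \<subseteq> V2 G" using assms v12 verts_eq unfolding V2_def by auto
  moreover have "finite (V2 G)" using fin verts_eq unfolding V2_def by auto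
  ultimately show ?thesis
    using card_Diff_subset[of "{v1, v2}" "V2 G"] card_mono[of "V2 G" "{v1, v2}"] distinct
    unfolding V by simp
qed

end

subsection \<open>Partial retracts\<close>

text \<open>Intermediate graphs of a sequence of bicontractions may contain loops.\<close>

definition pregraph :: "('v, 'e) mgraph \<Rightarrow> bool" where
  "pregraph G \<longleftrightarrow> finite (verts G) \<and> finite (edges G) \<and>
     (\<forall>e\<in>edges G. ends G e \<subseteq> verts G \<and> ends G e \<noteq> {} \<and> card (ends G e) \<le> 2)"

definition mbmc :: "('v, 'e) mgraph \<Rightarrow> bool" where
  "mbmc G \<longleftrightarrow> bipartite G \<and> minimal_matching_covered G"

lemma graph_imp_pregraph: "graph G \<Longrightarrow> pregraph G"
  unfolding graph_def pregraph_def by fastforce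

lemma pregraph_restricted_bicontraction:
  assumes G: "pregraph G" and step: "restricted_bicontraction G H"
  shows "pregraph H"
proof -
  obtain v v1 v2 where v: "v \<in> verts G" "degree G v = 2" "v1 \<noteq> v2" "neighbours G v = {v1, v2}"
    and H: "H = bicontraction G v" using step unfolding restricted_bicontraction_def by auto
  have fin: "finite (edges G)" "finite (verts G)" using G unfolding pregraph_def by auto
  have vn: "v \<notin> neighbours G v" using degree_two_edges[OF fin(1) v(2,4,3)] v(4) by blast
  have "ends H e \<subseteq> verts H \<and> ends H e \<noteq> {} \<and> card (ends H e) \<le> 2" if "e \<in> edges H" for e
  proof -
    have e: "ends G e \<subseteq> verts G" "ends G e \<noteq> {}" "card (ends G e) \<le> 2"
      using that G unfolding pregraph_def H by (auto simp: bicontraction_simps)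
    have "finite (ends G e)" using e(1) fin(2) by (rule finite_subset)
    then have "card (ends H e) \<le> 2"
      using e(3) card_image_le le_trans unfolding H bicontraction_simps by blast
    then show ?thesis using e(1,2) v(1) vn unfolding H by (auto simp: bicontraction_simps)
  qed
  then show ?thesis using fin unfolding pregraph_def H by (simp add: bicontraction_simps)
qed

lemma mbmc_sides:
  assumes "mbmc G"
  obtains A B where "minimal_bipartite G A B"
proof -
  have "graph G" using assms
    unfolding mbmc_def minimal_matching_covered_def matching_covered_def by simp
  then show thesis using assms that bipartite_iff[of G]
    unfolding mbmc_def minimal_bipartite_def minimal_bipartite_axioms_def bipartite_graph_def by auto
qed

lemma mbmc_sides_at:
  assumes "mbmc G" "v \<in> verts G"
  obtains A B where "minimal_bipartite G A B" "v \<in> B"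
proof -
  obtain A B where AB: "minimal_bipartite G A B" using assms(1) by (rule mbmc_sides)
  interpret minimal_bipartite G A B by (rule AB)
  show thesis
  proof (cases "v \<in> B")
    case True
    then show thesis using AB that by simp
  next
    case False
    then have "v \<in> A" using assms(2) verts_eq by simp
    then show thesis using swap_minimal that by simp
  qed
qed

lemma minimal_bipartite_imp_mbmc: "minimal_bipartite G A B \<Longrightarrow> mbmc G"
  unfolding mbmc_def minimal_bipartite_def minimal_bipartite_axioms_def bipartite_graph_def bipartite_iff
  by auto

context minimal_bipartite
begin

lemma bicontractibleI:
  assumes "v \<in> B" "neighbours G v = {v1, v2}" "v1 \<noteq> v2"
    and deg: "3 \<le> degree G v1 \<and> 3 \<le> degree G v2 \<or> degree G v1 = 2 \<and> degree G v2 = 2"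
    and "3 \<le> card A"
  shows "minimal_bicontractible G A B v v1 v2"
  using assms minimal_bipartite_axioms bipartite_graph_axioms
  unfolding minimal_bicontractible_def minimal_bicontractible_axioms_def
    bicontractible_def bicontractible_axioms_def by blast

text \<open>As there are no parallel edges, a degree counts distinct neighbours, all in one class. A
  vertex of large degree thus rules out small classes.\<close>

lemma degree_le_side:
  assumes "v \<in> verts G"
  shows "degree G v \<le> card A"
proof (cases "v \<in> A")
  case True
  then show ?thesis
    using card_mono[OF fin(2) neighbours_subset] degree_eq balanced by simp
next
  case False
  then have "v \<in> B" using assms verts_eq by simp
  then show ?thesis
    using card_mono[OF fin(1) bipartite_graph.neighbours_subset[OF swap]] degree_eq by simp
qed

lemma restricted_three:
  assumes "v \<in> B" "neighbours G v = {v1, v2}" "3 \<le> degree G v1"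
  shows "3 \<le> card A"
proof -
  have "v1 \<in> verts G" using bipartite_graph.neighbours_subset[OF swap assms(1)] assms(2) verts_eq by simp
  then show ?thesis using degree_le_side assms(3) le_trans by blast
qed

end

lemma mbmc_restricted_bicontraction:
  assumes G: "mbmc G" and step: "restricted_bicontraction G H"
  shows "mbmc H" "card (E2 H) = card (E2 G)" "card (V2 G) = Suc (card (V2 H))"
    "card (edges G) = card (edges H) + 2" "card (verts G) = card (verts H) + 2"
    "\<exists>v\<in>verts H. 4 \<le> degree H v"
proof -
  obtain v v1 v2 where hv: "v \<in> verts G" "v1 \<noteq> v2" "neighbours G v = {v1, v2}"
    "3 \<le> degree G v1" "3 \<le> degree G v2"
    and H: "H = bicontraction G v" using step unfolding restricted_bicontraction_def by auto
  obtain A B where AB: "minimal_bipartite G A B" "v \<in> B" using mbmc_sides_at[OF G hv(1)] .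
  interpret minimal_bicontractible G A B v v1 v2
    using minimal_bipartite.bicontractibleI[OF AB(1)] minimal_bipartite.restricted_three[OF AB(1)] AB(2) hv
    by simp
  show "mbmc H" using minimal_H minimal_bipartite_imp_mbmc H by blast
  show "card (E2 H) = card (E2 G)" "card (V2 G) = Suc (card (V2 H))"
    using restricted_counts hv H by auto
  show "card (edges G) = card (edges H) + 2" "card (verts G) = card (verts H) + 2"
    using card_edges_H card_verts_H H by auto
  have "4 \<le> degree H v" using degree_H_v hv unfolding H by linarith
  then show "\<exists>v\<in>verts H. 4 \<le> degree H v" using v_verts_H H by blast
qed

text \<open>The colouring is pulled back: \<open>v\<close> moves to the other class and its
  neighbours take its place. An edge away from \<open>v\<close> has two ends in \<open>G\<close>
  because its image under the contraction has two.\<close>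

lemma bipartite_graph_of_bicontraction:
  assumes G: "pregraph G" and v: "degree G v = 2" "neighbours G v = {v1, v2}" "v1 \<noteq> v2" "v \<in> verts G"
    and H: "bipartite_graph (bicontraction G v) A B" and vA: "v \<in> A"
  shows "bipartite_graph G (A - {v} \<union> {v1, v2}) (insert v B)"
proof
  interpret H: bipartite_graph "bicontraction G v" A B by (rule H)
  have fin: "finite (edges G)" "finite (verts G)" using G unfolding pregraph_def by auto
  obtain e1 e2 where e12: "e1 \<in> edges G" "e2 \<in> edges G" "ends G e1 = {v, v1}" "ends G e2 = {v, v2}"
    "{e \<in> edges G. v \<in> ends G e} = {e1, e2}" and vne: "v \<noteq> v1" "v \<noteq> v2"
    by (rule degree_two_edges[OF fin(1) v(1-3)]) (rule that)
  have vH: "verts G - {v1, v2} = A \<union> B" using H.verts_eq by (simp add: bicontraction_simps v(2))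
  have v12: "v1 \<in> verts G" "v2 \<in> verts G"
    using e12(1-4) G unfolding pregraph_def by auto
  have vB: "v \<notin> B" using vA H.disjoint by auto
  have key: "card (ends G e) = 2 \<and> (\<exists>a\<in>A - {v} \<union> {v1, v2}. \<exists>b\<in>insert v B. a \<in> ends G e \<and> b \<in> ends G e)"
    if e: "e \<in> edges G" for e
  proof (cases "v \<in> ends G e")
    case True
    then have "e = e1 \<or> e = e2" using e e12(5) by auto
    then show ?thesis using e12(3,4) vne by auto
  next
    case False
    let ?r = "\<lambda>u. if u \<in> neighbours G v then v else u"
    have eH: "e \<in> edges (bicontraction G v)" using e False by (simp add: bicontraction_simps)
    have ge: "finite (ends G e)" "card (ends G e) \<le> 2"
      using e G fin(2) unfolding pregraph_def by (auto intro: finite_subset)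
    obtain a b where ab: "a \<in> A" "b \<in> B" "ends (bicontraction G v) e = {a, b}"
      using H.edge_ends[OF eH] .
    then have img: "?r ` ends G e = {a, b}" by (simp add: bicontraction_simps)
    have "a \<noteq> b" using ab(1,2) H.disjoint by auto
    then have "2 \<le> card (ends G e)" using card_image_le[OF ge(1), of ?r] img by simp
    moreover have "a \<in> ?r ` ends G e" "b \<in> ?r ` ends G e" unfolding img by simp_all
    then obtain a' b' where a': "a' \<in> ends G e" "a = ?r a'" and b': "b' \<in> ends G e" "b = ?r b'"
      by (elim imageE) (rule that)
    have "b' = b" using b'(2) ab(2) vB by (auto split: if_splits)
    moreover have "a' \<in> A - {v} \<union> {v1, v2}"
      using a' ab(1) False v(2) by (auto split: if_splits)
    moreover have "b \<in> ends G e" "b \<in> insert v B" using \<open>b' = b\<close> b'(1) ab(2) by simp_all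
    ultimately show ?thesis using ge(2) a'(1) by (meson le_antisym)
  qed
  show "graph G" unfolding graph_def using G key fin unfolding pregraph_def by auto
  have "A - {v} \<union> {v1, v2} \<union> insert v B = verts G" using vH v12 v(4) vA by auto
  moreover have "(A - {v} \<union> {v1, v2}) \<inter> insert v B = {}" using H.disjoint vH vne by auto
  moreover have "ends G e \<inter> (A - {v} \<union> {v1, v2}) \<noteq> {} \<and> ends G e \<inter> insert v B \<noteq> {}"
    if "e \<in> edges G" for e using conjunct2[OF key[OF that]] by (elim bexE conjE) (intro conjI; rule notI; blast)
  ultimately show "bipartition G (A - {v} \<union> {v1, v2}) (insert v B)" unfolding bipartition_def by simp
qed

text \<open>An edge at \<open>v\<close> cannot be deleted, since \<open>v\<close> would keep only
  one neighbour. Any other edge is an edge of \<open>H\<close>, and deleting it commutes with the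
  bicontraction, so minimality comes from \<open>H\<close>.\<close>

lemma mbmc_of_restricted_bicontraction:
  assumes G: "pregraph G" and step: "restricted_bicontraction G H" and H: "mbmc H"
  shows "mbmc G"
proof -
  obtain v v1 v2 where hv: "v \<in> verts G" "degree G v = 2" "v1 \<noteq> v2" "neighbours G v = {v1, v2}"
    "3 \<le> degree G v1" "3 \<le> degree G v2"
    and Hv: "H = bicontraction G v" using step unfolding restricted_bicontraction_def by auto
  have finE: "finite (edges G)" using G unfolding pregraph_def by auto
  obtain e1 e2 where e12: "e1 \<in> edges G" "e2 \<in> edges G" "ends G e1 = {v, v1}" "ends G e2 = {v, v2}"
    "{e \<in> edges G. v \<in> ends G e} = {e1, e2}" and vne: "v \<noteq> v1" "v \<noteq> v2"
    by (rule degree_two_edges[OF finE hv(2,4,3)]) (rule that)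
  have "v \<in> verts H" using hv(1,4) vne unfolding Hv by (simp add: bicontraction_simps)
  then obtain B0 A0 where AB: "minimal_bipartite H B0 A0" "v \<in> A0" using mbmc_sides_at[OF H] by blast
  have minH: "minimal_bipartite H A0 B0" by (rule minimal_bipartite.swap_minimal[OF AB(1)])
  interpret H: minimal_bipartite H A0 B0 by (rule minH)
  define A where "A = A0 - {v} \<union> {v1, v2}"
  define B where "B = insert v B0"
  have bip: "bipartite_graph G A B"
    unfolding A_def B_def
    using bipartite_graph_of_bicontraction[OF G hv(2,4,3,1)] H.bipartite_graph_axioms AB(2) unfolding Hv by simp
  interpret bicontractible G A B v v1 v2
    using bip hv(3,4) unfolding bicontractible_def bicontractible_axioms_def B_def by simp
  have n12: "v1 \<notin> A0" "v2 \<notin> A0" "v \<notin> B0"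
    using H.verts_eq H.disjoint AB(2) hv(4) unfolding Hv by (auto simp: bicontraction_simps)
  have sides: "insert v (A - {v1, v2}) = A0" "B - {v} = B0"
    using n12 AB(2) unfolding A_def B_def by auto
  have three: "3 \<le> card A" using card_sides(1) H.balanced unfolding sides by simp
  \<comment> \<open>Since \<open>G\<close> is not yet known to be simple, degree at least three does
    not by itself give several neighbours. But only one edge joins \<open>w\<close> to
    \<open>v\<close>, so another edge at \<open>w\<close> leads to a second neighbour.\<close>
  have deg: "2 \<le> card (neighbours G w)"
    if w: "w \<in> {v1, v2}" "3 \<le> degree G w" "w \<in> A" and f: "f \<in> {e1, e2}" "\<And>g. g \<in> {e1, e2} \<Longrightarrow> w \<in> ends G g \<Longrightarrow> g = f"
    for w f
  proof -
    have "\<not> {e \<in> edges G. w \<in> ends G e} \<subseteq> {f}"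
    proof
      assume "{e \<in> edges G. w \<in> ends G e} \<subseteq> {f}"
      then have "card {e \<in> edges G. w \<in> ends G e} \<le> card {f}" by (rule card_mono[rotated]) simp
      then show False using w(2) degree_loopless[OF graph] by simp
    qed
    then obtain g where g: "g \<in> edges G" "w \<in> ends G g" "g \<noteq> f" by blast
    have vg: "v \<notin> ends G g" using g f e12(5) by blast
    obtain a b where ab: "a \<in> A" "b \<in> B" "ends G g = {a, b}" using edge_ends[OF g(1)] .
    then have "w = a" using pair_end(1)[OF ab(1,2)] g(2) w(3) by simp
    then have "b \<in> neighbours G w" using ab g(1) unfolding neighbours_def by auto
    moreover have "v \<in> neighbours G w" using w(1) hv(4) neighbours_sym[of v G w] by simp
    moreover have "b \<noteq> v" using vg ab(3) by auto
    ultimately have "{b, v} \<subseteq> neighbours G w" "card {b, v} = 2" by simp_all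
    then show ?thesis using card_mono[OF neighbours_finite, of "{b, v}" w] by simp
  qed
  have "2 \<le> card (neighbours G v1)"
    using hv(3,5) v12 e12(3,4) vne by (intro deg[of v1 e1]) auto
  moreover have "2 \<le> card (neighbours G v2)"
    using hv(3,6) v12 e12(3,4) vne by (intro deg[of v2 e2]) auto
  ultimately have mcG: "matching_covered G"
    using matching_covered_of_bicontraction H.mc unfolding Hv by simp
  have "\<not> matching_covered (delete_edge G e)" if e: "e \<in> edges G" for e
  proof
    assume mcD: "matching_covered (delete_edge G e)"
    show False
    proof (cases "v \<in> ends G e")
      case True
      interpret D: bipartite_graph "delete_edge G e" B A
        by (rule bipartite_graph.swap[OF delete_edge])
      have D: "2 \<le> card B" "surplus B (adj (delete_edge G e) B)"
        using mcD D.matching_covered_iff by auto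
      have "{v} \<noteq> B" using D(1) by auto
      then have "card {v} < card (adj (delete_edge G e) B `` {v})"
        using D(2)[unfolded surplus_def, rule_format, of "{v}"] v by simp
      then have "1 < card (neighbours (delete_edge G e) v)"
        using D.adj_singleton[OF v] by simp
      moreover have "e = e1 \<or> e = e2" using e True e12(5) by auto
      then have "neighbours (delete_edge G e) v \<subseteq> {v2} \<or> neighbours (delete_edge G e) v \<subseteq> {v1}"
      proof
        have sub: "w = v1 \<and> e \<noteq> e1 \<or> w = v2 \<and> e \<noteq> e2"
          if w: "w \<in> neighbours (delete_edge G e) v" for w
        proof -
          obtain f where f: "f \<in> edges G" "f \<noteq> e" "ends G f = {v, w}"
            using w unfolding neighbours_def delete_edge_def by auto
          then have "f = e1 \<or> f = e2" using e12(5) by auto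
          then show ?thesis using f e12(3,4) by (auto simp: doubleton_eq_iff)
        qed
        { assume "e = e1" then show ?thesis using sub by blast }
        { assume "e = e2" then show ?thesis using sub by blast }
      qed
      then have "card (neighbours (delete_edge G e) v) \<le> 1"
        using card_mono[of "{v2}"] card_mono[of "{v1}"] by fastforce
      ultimately show False by simp
    next
      case False
      interpret D: bicontractible "delete_edge G e" A B v v1 v2 by (rule delete_bicontractible[OF False])
      have "matching_covered (bicontraction (delete_edge G e) v)"
        using D.matching_covered_bicontraction[OF mcD three] .
      then have "matching_covered (delete_edge H e)"
        unfolding Hv bicontraction_delete_edge(2)[OF False] .
      moreover have "e \<in> edges H" using e False unfolding Hv by (simp add: bicontraction_simps)
      ultimately show False using H.not_mc by blast
    qed
  qed
  then have "minimal_bipartite G A B"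
    using mcG bip unfolding minimal_bipartite_def minimal_bipartite_axioms_def minimal_matching_covered_def
    by simp
  then show ?thesis by (rule minimal_bipartite_imp_mbmc)
qed

text \<open>All degrees are at least two, so if neither neighbour of \<open>v\<close> had degree
  two, a restricted bicontraction at \<open>v\<close> would be possible.\<close>

lemma irreducible_V2_neighbour:
  assumes G: "mbmc G" and irr: "\<nexists>K. restricted_bicontraction G K" and v: "v \<in> V2 G"
  shows "\<exists>w\<in>neighbours G v. degree G w = 2"
proof -
  obtain A B where AB: "minimal_bipartite G A B" "v \<in> B"
    using mbmc_sides_at[OF G, of v] v unfolding V2_def by blast
  interpret minimal_bipartite G A B by (rule AB(1))
  have "card (neighbours G v) = 2" using v degree_eq unfolding V2_def by simp
  then obtain v1 v2 where v12: "neighbours G v = {v1, v2}" "v1 \<noteq> v2" by (auto simp: card_2_iff)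
  have "v1 \<in> A" "v2 \<in> A" using bipartite_graph.neighbours_subset[OF swap AB(2)] v12 by auto
  then have ge: "2 \<le> degree G v1" "2 \<le> degree G v2" using degree_ge_two by auto
  have "\<not> (3 \<le> degree G v1 \<and> 3 \<le> degree G v2)"
    using irr v v12 unfolding restricted_bicontraction_def V2_def by blast
  then have "degree G v1 = 2 \<or> degree G v2 = 2" using ge by linarith
  then show ?thesis using v12 by auto
qed

text \<open>Restricted bicontraction keeps \<open>m - n\<close> and lowers |\<open>V2\<close>|, so
  the bound passes back from irreducible graphs to all. This generality matters because contracting
  a path of vertices of degree two may yield a reducible graph.\<close>

lemma card_V2_bound:
  assumes "mbmc G"
  shows "2 * (int (card (edges G)) - int (card (verts G)) + 2) \<le> int (card (V2 G))"
  using assms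
proof (induction "card (edges G)" arbitrary: G rule: less_induct)
  case less
  show ?case
  proof (cases "\<exists>K. restricted_bicontraction G K")
    case True
    then obtain K where K: "restricted_bicontraction G K" ..
    note K' = mbmc_restricted_bicontraction[OF less.prems K]
    have "2 * (int (card (edges K)) - int (card (verts K)) + 2) \<le> int (card (V2 K))"
      using less.hyps[of K] K'(1,4) by simp
    then show ?thesis using K'(3-5) by simp
  next
    case False
    obtain A B where "minimal_bipartite G A B" using less.prems by (rule mbmc_sides)
    then show ?thesis
      using irreducible_V2_neighbour[OF less.prems False] by (intro minimal_bipartite.card_V2_irreducible)
  qed
qed

section \<open>Vertices of degree two against 2-edges, and the theorem\<close>

lemma sum_card_E2:
  assumes "graph G"
  shows "(\<Sum>v\<in>V2 G. card {e \<in> E2 G. v \<in> ends G e}) = 2 * card (E2 G)"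
proof (rule sum_multicount)
  show "finite (V2 G)" "finite (E2 G)" using assms unfolding graph_def V2_def E2_def by auto
  show "\<forall>e\<in>E2 G. card {v \<in> V2 G. v \<in> ends G e} = 2"
  proof
    fix e assume e: "e \<in> E2 G"
    then have "{v \<in> V2 G. v \<in> ends G e} = ends G e" unfolding E2_def by auto
    then show "card {v \<in> V2 G. v \<in> ends G e} = 2" using e assms unfolding graph_def E2_def by simp
  qed
qed

text \<open>Every vertex of degree two lies on a 2-edge, and a 2-edge has only two ends.\<close>

lemma irreducible_card_V2_le:
  assumes G: "mbmc G" and irr: "\<nexists>K. restricted_bicontraction G K"
  shows "card (V2 G) \<le> 2 * card (E2 G)"
proof -
  obtain A B where AB: "minimal_bipartite G A B" using G by (rule mbmc_sides)
  interpret minimal_bipartite G A B by (rule AB)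
  have "1 \<le> card {e \<in> E2 G. v \<in> ends G e}" if v: "v \<in> V2 G" for v
  proof -
    obtain w where w: "w \<in> neighbours G v" "degree G w = 2"
      using irreducible_V2_neighbour[OF G irr v] by blast
    obtain e where e: "e \<in> edges G" "ends G e = {v, w}" using w(1) unfolding neighbours_def by blast
    then have "w \<in> verts G" using graph unfolding graph_def by blast
    then have "e \<in> {e \<in> E2 G. v \<in> ends G e}" using e w(2) v unfolding E2_def V2_def by simp
    moreover have "finite {e \<in> E2 G. v \<in> ends G e}" using fin unfolding E2_def by simp
    ultimately show ?thesis by (metis One_nat_def Suc_leI card_gt_0_iff empty_iff)
  qed
  then have "card (V2 G) * 1 \<le> (\<Sum>v\<in>V2 G. card {e \<in> E2 G. v \<in> ends G e})"
    using sum_bounded_below[of "V2 G" 1 "\<lambda>v. card {e \<in> E2 G. v \<in> ends G e}"] by simp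
  then show ?thesis using sum_card_E2[OF graph] by simp
qed

text \<open>Bicontracting the middle vertex of a path of three vertices of degree two
  preserves \<open>m - n\<close> but loses two vertices of degree two.\<close>

lemma vertex_extremal_card_E2_le:
  assumes G: "minimal_bipartite G A B" and three: "3 \<le> card A"
    and ext: "int (card (V2 G)) = 2 * (int (card (edges G)) - int (card (verts G)) + 2)"
  shows "2 * card (E2 G) \<le> card (V2 G)"
proof -
  have "card {e \<in> E2 G. v \<in> ends G e} \<le> 1" if v: "v \<in> V2 G" for v
  proof (rule ccontr)
    assume two: "\<not> ?thesis"
    interpret G0: minimal_bipartite G A B by (rule G)
    have "v \<in> A \<or> v \<in> B" using v G0.verts_eq unfolding V2_def by auto
    \<comment> \<open>The classes are interchanged if necessary, so that \<open>v\<close> lies in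
      \<open>B\<close>.\<close>
    then obtain A B where AB: "minimal_bipartite G A B" "v \<in> B" "3 \<le> card A"
      using G G0.swap_minimal three G0.balanced(1) by auto
    interpret minimal_bipartite G A B by (rule AB(1))
    have "card (neighbours G v) = 2" using v degree_eq unfolding V2_def by simp
    then obtain v1 v2 where v12: "neighbours G v = {v1, v2}" "v1 \<noteq> v2" by (auto simp: card_2_iff)
    have dv: "degree G v = 2" using v unfolding V2_def by simp
    obtain e1 e2 where e12: "e1 \<noteq> e2" "ends G e1 = {v, v1}" "ends G e2 = {v, v2}"
      "{e \<in> edges G. v \<in> ends G e} = {e1, e2}"
      by (rule degree_two_edges[OF fin(3) dv v12]) (rule that)
    have sub: "{e \<in> E2 G. v \<in> ends G e} \<subseteq> {e1, e2}" using e12(4) unfolding E2_def by blast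
    moreover have "card {e1, e2} \<le> card {e \<in> E2 G. v \<in> ends G e}" using two e12(1) by simp
    ultimately have "{e \<in> E2 G. v \<in> ends G e} = {e1, e2}" by (intro card_seteq) auto
    then have "e1 \<in> E2 G" "e2 \<in> E2 G" by auto
    then have d: "degree G v1 = 2" "degree G v2 = 2" using e12(2,3) unfolding E2_def V2_def by auto
    interpret minimal_bicontractible G A B v v1 v2
      using bicontractibleI[OF AB(2) v12] d AB(3) by simp
    have "2 * (int (card (edges H)) - int (card (verts H)) + 2) \<le> int (card (V2 H))"
      using card_V2_bound minimal_bipartite_imp_mbmc[OF minimal_H] by simp
    then show False using ext path_counts[OF d] card_edges_H card_verts_H by simp
  qed
  then have "(\<Sum>v\<in>V2 G. card {e \<in> E2 G. v \<in> ends G e}) \<le> card (V2 G) * 1"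
    using sum_bounded_above[of "V2 G" "\<lambda>v. card {e \<in> E2 G. v \<in> ends G e}" 1] by simp
  then show ?thesis
    using sum_card_E2[of G] bipartite_graph.graph[of G A B] G unfolding minimal_bipartite_def by simp
qed

text \<open>Minimum degree two makes every vertex adjacent to the whole opposite class, and there
  are no parallel edges, so the four edges form a cycle.\<close>

lemma four_vertices_isomorphic_C4:
  assumes "minimal_bipartite G A B" "card A = 2"
  shows "isomorphic G C4"
proof -
  interpret minimal_bipartite G A B by (rule assms(1))
  obtain a0 a1 where A: "A = {a0, a1}" "a0 \<noteq> a1" using assms(2) by (auto simp: card_2_iff)
  obtain b0 b1 where B: "B = {b0, b1}" "b0 \<noteq> b1" using assms(2) balanced by (auto simp: card_2_iff)
  have full: "\<exists>e\<in>edges G. ends G e = {a, b}" if "a \<in> A" "b \<in> B" for a b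
  proof -
    have "2 \<le> card (neighbours G a)" using degree_ge_two[OF that(1)] degree_eq by simp
    then have "neighbours G a = B"
      using neighbours_subset[OF that(1)] fin(2) balanced assms(2) by (intro card_seteq) auto
    then show ?thesis using that(2) unfolding neighbours_def by blast
  qed
  obtain e0 where e0: "e0 \<in> edges G" "ends G e0 = {a0, b0}" using full[of a0 b0] A B by blast
  obtain e1 where e1: "e1 \<in> edges G" "ends G e1 = {a1, b0}" using full[of a1 b0] A B by blast
  obtain e2 where e2: "e2 \<in> edges G" "ends G e2 = {a1, b1}" using full[of a1 b1] A B by blast
  obtain e3 where e3: "e3 \<in> edges G" "ends G e3 = {a0, b1}" using full[of a0 b1] A B by blast
  have ne: "a0 \<noteq> b0" "a0 \<noteq> b1" "a1 \<noteq> b0" "a1 \<noteq> b1" using disjoint A B by auto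
  have dist: "e0 \<noteq> e1" "e0 \<noteq> e2" "e0 \<noteq> e3" "e1 \<noteq> e2" "e1 \<noteq> e3" "e2 \<noteq> e3"
    using e0 e1 e2 e3 ne A(2) B(2) by (metis doubleton_eq_iff)+
  have E: "edges G = {e0, e1, e2, e3}"
  proof
    show "edges G \<subseteq> {e0, e1, e2, e3}"
    proof
      fix e assume e: "e \<in> edges G"
      obtain a b where "a \<in> A" "b \<in> B" "ends G e = {a, b}" using edge_ends[OF e] .
      then have "ends G e = ends G e0 \<or> ends G e = ends G e1 \<or> ends G e = ends G e2 \<or> ends G e = ends G e3"
        using e0(2) e1(2) e2(2) e3(2) A(1) B(1) by auto
      then show "e \<in> {e0, e1, e2, e3}"
        using inj_onD[OF inj_ends _ e] e0(1) e1(1) e2(1) e3(1) by auto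
    qed
  qed (use e0 e1 e2 e3 in auto)
  have V: "verts G = {a0, a1, b0, b1}" using verts_eq A B by auto
  have four: "{..<4::nat} = {0, 1, 2, 3}" by auto
  \<comment> \<open>Vertices are numbered in the cyclic order \<open>a0\<close>, \<open>b0\<close>,
    \<open>a1\<close>, \<open>b1\<close>, and edges accordingly.\<close>
  let ?f = "\<lambda>x. if x = a0 then 0 else if x = b0 then 1 else if x = a1 then 2 else 3 :: nat"
  let ?g = "\<lambda>e. if e = e0 then 0 else if e = e1 then 1 else if e = e2 then 2 else 3 :: nat"
  have "bij_betw ?f (verts G) (verts C4)"
    unfolding V C4_def bij_betw_def using ne A(2) B(2) four by (auto simp: inj_on_def)
  moreover have "bij_betw ?g (edges G) (edges C4)"
    unfolding E C4_def bij_betw_def using dist four by (auto simp: inj_on_def)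
  moreover have "\<forall>e\<in>edges G. ends C4 (?g e) = ?f ` ends G e"
    unfolding E using dist ne A(2) B(2) e0(2) e1(2) e2(2) e3(2) by (auto simp: C4_def)
  ultimately show ?thesis unfolding isomorphic_def by blast
qed

text \<open>\<open>pregraph\<close> is carried along because the backward implication for
  \<open>mbmc\<close> must handle intermediate graphs about which nothing stronger is known.\<close>

lemma restricted_bicontractions_invariants:
  assumes "restricted_bicontraction\<^sup>*\<^sup>* G H" "pregraph G"
  shows "pregraph H \<and> (mbmc G \<longleftrightarrow> mbmc H) \<and> (mbmc G \<longrightarrow> card (E2 H) = card (E2 G) \<and>
      int (card (edges H)) - int (card (verts H)) = int (card (edges G)) - int (card (verts G)))"
  using assms(1)
proof induction
  case base
  then show ?case using assms(2) by simp
next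
  case (step K L)
  have K: "pregraph K" using step.IH by blast
  have L: "pregraph L" using pregraph_restricted_bicontraction[OF K step.hyps(2)] .
  have iff: "mbmc K \<longleftrightarrow> mbmc L"
    using mbmc_restricted_bicontraction(1)[OF _ step.hyps(2)]
      mbmc_of_restricted_bicontraction[OF K step.hyps(2)] by blast
  have "card (E2 L) = card (E2 K)" "card (edges K) = card (edges L) + 2"
    "card (verts K) = card (verts L) + 2" if "mbmc K"
    using mbmc_restricted_bicontraction[OF that step.hyps(2)] by auto
  then show ?case using step.IH iff L by auto
qed

theorem theorem1p9:
  fixes G H :: "('v, 'e) mgraph"
  assumes "graph G"
    and "\<not> isomorphic G C4"
    and "partial_retract G H"
  shows "two_edge_extremal_mbmc G \<longleftrightarrow> two_vertex_extremal_mbmc H"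
proof -
  have steps: "restricted_bicontraction\<^sup>*\<^sup>* G H" and irr: "\<nexists>K. restricted_bicontraction H K"
    using assms(3) unfolding partial_retract_def by auto
  have pG: "pregraph G" using assms(1) by (rule graph_imp_pregraph)
  note inv = restricted_bicontractions_invariants[OF steps pG]
  let ?k = "int (card (edges H)) - int (card (verts H)) + 2"
  have "two_edge_extremal_mbmc G \<longleftrightarrow> mbmc H \<and> int (card (E2 H)) = ?k"
    unfolding two_edge_extremal_mbmc_def using inv unfolding mbmc_def by auto
  moreover have "two_vertex_extremal_mbmc H \<longleftrightarrow> mbmc H \<and> int (card (V2 H)) = 2 * ?k"
    unfolding two_vertex_extremal_mbmc_def mbmc_def by auto
  moreover have "int (card (E2 H)) = ?k \<longleftrightarrow> int (card (V2 H)) = 2 * ?k" if H: "mbmc H"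
  proof
    have le: "card (V2 H) \<le> 2 * card (E2 H)" by (rule irreducible_card_V2_le[OF H irr])
    \<comment> \<open>The general lower bound on |\<open>V2 H\<close>| meets the upper bound
      \<open>2 * card (E2 H)\<close>.\<close>
    show "int (card (V2 H)) = 2 * ?k" if "int (card (E2 H)) = ?k"
      using le card_V2_bound[OF H] that by presburger
    assume ext: "int (card (V2 H)) = 2 * ?k"
    obtain A B where AB: "minimal_bipartite H A B" using H by (rule mbmc_sides)
    interpret H: minimal_bipartite H A B by (rule AB)
    \<comment> \<open>With classes of size two, \<open>H\<close> is a four-cycle and hence different
      from \<open>G\<close>. It then arises by a restricted bicontraction, whose contraction vertex
      has degree at least four, too much for a class of size two.\<close>
    have "card A \<noteq> 2"
    proof
      assume two: "card A = 2"
      have "H \<noteq> G" using four_vertices_isomorphic_C4[OF AB two] assms(2) by blast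
      then obtain K where K: "restricted_bicontraction\<^sup>*\<^sup>* G K" "restricted_bicontraction K H"
        using steps by (metis rtranclp.cases)
      have "mbmc K"
        using mbmc_of_restricted_bicontraction[OF _ K(2) H]
          restricted_bicontractions_invariants[OF K(1) pG] by blast
      then obtain v where "v \<in> verts H" "4 \<le> degree H v"
        using mbmc_restricted_bicontraction(6)[OF _ K(2)] by blast
      then show False using H.degree_le_side[of v] two by simp
    qed
    then have "3 \<le> card A" using H.balanced(2) by simp
    then have "2 * card (E2 H) \<le> card (V2 H)"
      using vertex_extremal_card_E2_le[OF AB _ ext] by simp
    then show "int (card (E2 H)) = ?k" using le ext by presburger
  qed
  ultimately show ?thesis by blast
qed

end
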